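(* Let $T$ be a complete theory with infinite models in a language $\mathcal L\supseteq\mathcal L_{\mathrm{ring}}$, extending the $\mathcal L_{\mathrm{ring}}$-theory of fields, and suppose that $T$ is pregeometric. If $T$ is stable, then $T$ is strongly minimal.
   Context: $T$ is pregeometric if in every model of $T$ the model-theoretic algebraic closure $\mathrm{acl}_{\mathcal L}$ is a pregeometry, i.e. it satisfies exchange: $a\in\mathrm{acl}(A,b)\setminus\mathrm{acl}(A)\Rightarrow b\in\mathrm{acl}(A,a)$. *)

theory Defs
  imports "HOL-Library.Equipollence"
begin

text \<open>
  Single-sorted first-order logic with equality.  A language consists of sets of function and
  relation symbols (constants are 0-ary functions) drawn from arbitrary types of names, so
  that it may have any cardinality and may have no relation symbols at all.
\<close>

record ('f, 'r) lang =
  Funs :: "'f set"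
  Rels :: "'r set"
  farity :: "'f \<Rightarrow> nat"
  rarity :: "'r \<Rightarrow> nat"

definition sublang :: "('f, 'r) lang \<Rightarrow> ('f, 'r) lang \<Rightarrow> bool" where
  "sublang L0 L \<longleftrightarrow>
     Funs L0 \<subseteq> Funs L \<and> (\<forall>f\<in>Funs L0. farity L f = farity L0 f) \<and>
     Rels L0 \<subseteq> Rels L \<and> (\<forall>r\<in>Rels L0. rarity L r = rarity L0 r)"

datatype 'f trm = Var nat | App 'f "'f trm list"

datatype ('f, 'r) fm =
    Eq "'f trm" "'f trm"
  | Rel 'r "'f trm list"
  | Neg "('f, 'r) fm"
  | And "('f, 'r) fm" "('f, 'r) fm"
  | Exi nat "('f, 'r) fm"

abbreviation Imp :: "('f, 'r) fm \<Rightarrow> ('f, 'r) fm \<Rightarrow> ('f, 'r) fm" where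
  "Imp p q \<equiv> Neg (And p (Neg q))"

abbreviation Uni :: "nat \<Rightarrow> ('f, 'r) fm \<Rightarrow> ('f, 'r) fm" where
  "Uni x p \<equiv> Neg (Exi x (Neg p))"

fun tvars :: "'f trm \<Rightarrow> nat set" where
  "tvars (Var x) = {x}"
| "tvars (App f ts) = (\<Union>t\<in>set ts. tvars t)"

fun fv :: "('f, 'r) fm \<Rightarrow> nat set" where
  "fv (Eq s t) = tvars s \<union> tvars t"
| "fv (Rel r ts) = (\<Union>t\<in>set ts. tvars t)"
| "fv (Neg p) = fv p"
| "fv (And p q) = fv p \<union> fv q"
| "fv (Exi x p) = fv p - {x}"

fun is_term :: "('f, 'r) lang \<Rightarrow> 'f trm \<Rightarrow> bool" where
  "is_term L (Var x) \<longleftrightarrow> True"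
| "is_term L (App f ts) \<longleftrightarrow> f \<in> Funs L \<and> length ts = farity L f \<and> (\<forall>t\<in>set ts. is_term L t)"

fun is_formula :: "('f, 'r) lang \<Rightarrow> ('f, 'r) fm \<Rightarrow> bool" where
  "is_formula L (Eq s t) \<longleftrightarrow> is_term L s \<and> is_term L t"
| "is_formula L (Rel r ts) \<longleftrightarrow> r \<in> Rels L \<and> length ts = rarity L r \<and> (\<forall>t\<in>set ts. is_term L t)"
| "is_formula L (Neg p) \<longleftrightarrow> is_formula L p"
| "is_formula L (And p q) \<longleftrightarrow> is_formula L p \<and> is_formula L q"
| "is_formula L (Exi x p) \<longleftrightarrow> is_formula L p"

definition is_sentence :: "('f, 'r) lang \<Rightarrow> ('f, 'r) fm \<Rightarrow> bool" where
  "is_sentence L p \<longleftrightarrow> is_formula L p \<and> fv p = {}"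

definition is_theory :: "('f, 'r) lang \<Rightarrow> ('f, 'r) fm set \<Rightarrow> bool" where
  "is_theory L T \<longleftrightarrow> (\<forall>p\<in>T. is_sentence L p)"

record ('f, 'r, 'u) struc =
  univ :: "'u set"
  fint :: "'f \<Rightarrow> 'u list \<Rightarrow> 'u"
  rint :: "'r \<Rightarrow> 'u list \<Rightarrow> bool"

definition is_struc :: "('f, 'r) lang \<Rightarrow> ('f, 'r, 'u) struc \<Rightarrow> bool" where
  "is_struc L M \<longleftrightarrow> univ M \<noteq> {} \<and>
     (\<forall>f\<in>Funs L. \<forall>as. set as \<subseteq> univ M \<and> length as = farity L f \<longrightarrow> fint M f as \<in> univ M)"

fun tval :: "('f, 'r, 'u) struc \<Rightarrow> (nat \<Rightarrow> 'u) \<Rightarrow> 'f trm \<Rightarrow> 'u" where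
  "tval M e (Var x) = e x"
| "tval M e (App f ts) = fint M f (map (tval M e) ts)"

fun sat :: "('f, 'r, 'u) struc \<Rightarrow> (nat \<Rightarrow> 'u) \<Rightarrow> ('f, 'r) fm \<Rightarrow> bool" where
  "sat M e (Eq s t) \<longleftrightarrow> tval M e s = tval M e t"
| "sat M e (Rel r ts) \<longleftrightarrow> rint M r (map (tval M e) ts)"
| "sat M e (Neg p) \<longleftrightarrow> \<not> sat M e p"
| "sat M e (And p q) \<longleftrightarrow> sat M e p \<and> sat M e q"
| "sat M e (Exi x p) \<longleftrightarrow> (\<exists>a\<in>univ M. sat M (e(x := a)) p)"

definition holds :: "('f, 'r, 'u) struc \<Rightarrow> ('f, 'r) fm \<Rightarrow> bool" where
  "holds M p \<longleftrightarrow> (\<forall>e. range e \<subseteq> univ M \<longrightarrow> sat M e p)"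

definition is_model :: "('f, 'r) lang \<Rightarrow> ('f, 'r) fm set \<Rightarrow> ('f, 'r, 'u) struc \<Rightarrow> bool" where
  "is_model L T M \<longleftrightarrow> is_struc L M \<and> (\<forall>p\<in>T. holds M p)"

text \<open>
  HOL cannot quantify over types inside a formula, so every notion about ``all models of
  \<open>T\<close>'' takes a type \<open>'u\<close> and ranges over the models whose universe is a subset of \<open>'u\<close>.
  By the downward Loewenheim-Skolem theorem each of the notions below is independent of
  \<open>'u\<close> as soon as \<open>'u\<close> is \<^emph>\<open>large for\<close> \<open>L\<close>, i.e. has at least \<open>max |L| aleph_0\<close> elements, which
  is the number of \<open>L\<close>-formulas.  A hypothesis on \<open>T\<close> is therefore stated for a large type
  \<open>'u\<close>, whereas a conclusion can be stated for an unrelated, arbitrary type \<open>'v\<close>, so that it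
  covers models of every size.
\<close>

definition large_for :: "'u itself \<Rightarrow> ('f, 'r) lang \<Rightarrow> bool" where
  "large_for U L \<longleftrightarrow> {p. is_formula L p} \<lesssim> (UNIV :: 'u set)"

definition entails :: "'u itself \<Rightarrow> ('f, 'r) lang \<Rightarrow> ('f, 'r) fm set \<Rightarrow> ('f, 'r) fm \<Rightarrow> bool" where
  "entails U L T p \<longleftrightarrow> (\<forall>M :: ('f, 'r, 'u) struc. is_model L T M \<longrightarrow> holds M p)"

definition complete_theory :: "'u itself \<Rightarrow> ('f, 'r) lang \<Rightarrow> ('f, 'r) fm set \<Rightarrow> bool" where
  "complete_theory U L T \<longleftrightarrow> is_theory L T \<and>
     (\<exists>M :: ('f, 'r, 'u) struc. is_model L T M) \<and>
     (\<forall>p. is_sentence L p \<longrightarrow> entails U L T p \<or> entails U L T (Neg p))"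

definition has_infinite_model :: "'u itself \<Rightarrow> ('f, 'r) lang \<Rightarrow> ('f, 'r) fm set \<Rightarrow> bool" where
  "has_infinite_model U L T \<longleftrightarrow>
     (\<exists>M :: ('f, 'r, 'u) struc. is_model L T M \<and> infinite (univ M))"

text \<open>
  \<open>X\<close> is a subset of the universe (not of a Cartesian power) that is definable with parameters
  from \<open>A\<close>: the variable \<open>x\<close> ranges over \<open>X\<close>, and \<open>e\<close> assigns parameters to the other free
  variables.
\<close>

definition definable_over ::
    "('f, 'r) lang \<Rightarrow> ('f, 'r, 'u) struc \<Rightarrow> 'u set \<Rightarrow> 'u set \<Rightarrow> bool" where
  "definable_over L M A X \<longleftrightarrow>
     (\<exists>p x e. is_formula L p \<and> (\<forall>y\<in>fv p - {x}. e y \<in> A) \<and>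
        X = {c \<in> univ M. sat M (e(x := c)) p})"

definition acl :: "('f, 'r) lang \<Rightarrow> ('f, 'r, 'u) struc \<Rightarrow> 'u set \<Rightarrow> 'u set" where
  "acl L M A = \<Union> {X. definable_over L M A X \<and> finite X}"

definition pregeometric :: "'u itself \<Rightarrow> ('f, 'r) lang \<Rightarrow> ('f, 'r) fm set \<Rightarrow> bool" where
  "pregeometric U L T \<longleftrightarrow>
     (\<forall>M :: ('f, 'r, 'u) struc. is_model L T M \<longrightarrow>
        (\<forall>A a b. A \<subseteq> univ M \<and> a \<in> univ M \<and> b \<in> univ M \<and>
           a \<in> acl L M (insert b A) - acl L M A \<longrightarrow> b \<in> acl L M (insert a A)))"

text \<open>
  In the order property the variables of \<open>p\<close> are split into the tuple of those in \<open>V\<close> and the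
  tuple of those not in \<open>V\<close>; \<open>a i\<close> and \<open>b j\<close> are assignments of which only the values on the
  first, respectively second, tuple matter.
\<close>

definition order_property_in ::
    "('f, 'r, 'u) struc \<Rightarrow> ('f, 'r) fm \<Rightarrow> nat set \<Rightarrow> bool" where
  "order_property_in M p V \<longleftrightarrow>
     (\<exists>a b :: nat \<Rightarrow> nat \<Rightarrow> 'u.
        (\<forall>i. range (a i) \<subseteq> univ M) \<and> (\<forall>j. range (b j) \<subseteq> univ M) \<and>
        (\<forall>i j. sat M (\<lambda>x. if x \<in> V then a i x else b j x) p \<longleftrightarrow> i < j))"

definition stable_theory :: "'u itself \<Rightarrow> ('f, 'r) lang \<Rightarrow> ('f, 'r) fm set \<Rightarrow> bool" where
  "stable_theory U L T \<longleftrightarrow>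
     \<not> (\<exists>(M :: ('f, 'r, 'u) struc) p V.
          is_model L T M \<and> is_formula L p \<and> order_property_in M p V)"

definition strongly_minimal :: "'u itself \<Rightarrow> ('f, 'r) lang \<Rightarrow> ('f, 'r) fm set \<Rightarrow> bool" where
  "strongly_minimal U L T \<longleftrightarrow>
     (\<forall>M :: ('f, 'r, 'u) struc. is_model L T M \<longrightarrow>
        infinite (univ M) \<and>
        (\<forall>X. definable_over L M (univ M) X \<longrightarrow> finite X \<or> finite (univ M - X)))"

text \<open>
  The language of rings has the function symbols 0, 1, binary addition and multiplication, and
  unary negation.  To let a language literally contain it, function symbols are taken from a
  sum type whose left summand consists of the ring symbols.
\<close>

datatype ring_sym = RZero | ROne | RPlus | RNeg | RTimes

fun ring_arity :: "ring_sym \<Rightarrow> nat" where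
  "ring_arity RZero = 0"
| "ring_arity ROne = 0"
| "ring_arity RPlus = 2"
| "ring_arity RNeg = 1"
| "ring_arity RTimes = 2"

definition L_ring :: "(ring_sym + 'f, 'r) lang" where
  "L_ring = \<lparr>Funs = range Inl, Rels = {},
     farity = case_sum ring_arity (\<lambda>_. 0), rarity = (\<lambda>_. 0)\<rparr>"

abbreviation tzero :: "(ring_sym + 'f) trm" where
  "tzero \<equiv> App (Inl RZero) []"
abbreviation tone :: "(ring_sym + 'f) trm" where
  "tone \<equiv> App (Inl ROne) []"
abbreviation tplus :: "(ring_sym + 'f) trm \<Rightarrow> (ring_sym + 'f) trm \<Rightarrow> (ring_sym + 'f) trm" where
  "tplus s t \<equiv> App (Inl RPlus) [s, t]"
abbreviation tneg :: "(ring_sym + 'f) trm \<Rightarrow> (ring_sym + 'f) trm" where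
  "tneg s \<equiv> App (Inl RNeg) [s]"
abbreviation ttimes :: "(ring_sym + 'f) trm \<Rightarrow> (ring_sym + 'f) trm \<Rightarrow> (ring_sym + 'f) trm" where
  "ttimes s t \<equiv> App (Inl RTimes) [s, t]"

definition field_axioms :: "(ring_sym + 'f, 'r) fm set" where
  "field_axioms =
    (let x = Var 0; y = Var 1; z = Var 2 in
     {Uni 0 (Uni 1 (Uni 2 (Eq (tplus (tplus x y) z) (tplus x (tplus y z))))),
      Uni 0 (Uni 1 (Eq (tplus x y) (tplus y x))),
      Uni 0 (Eq (tplus x tzero) x),
      Uni 0 (Eq (tplus x (tneg x)) tzero),
      Uni 0 (Uni 1 (Uni 2 (Eq (ttimes (ttimes x y) z) (ttimes x (ttimes y z))))),
      Uni 0 (Uni 1 (Eq (ttimes x y) (ttimes y x))),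
      Uni 0 (Eq (ttimes x tone) x),
      Uni 0 (Uni 1 (Uni 2 (Eq (ttimes x (tplus y z)) (tplus (ttimes x y) (ttimes x z))))),
      Neg (Eq tzero tone),
      Uni 0 (Imp (Neg (Eq x tzero)) (Exi 1 (Eq (ttimes x y) tone)))})"

end

theory Submission
  imports "HOL-Algebra.Multiplicative_Group" Defs
begin

text \<open>
  Let \<open>X\<close> be a definable subset of a model \<open>K\<close> such that \<open>X\<close> and \<open>K - X\<close> are infinite.
  Given an infinite definable \<open>Y\<close>, choose in an elementary extension independent points
  \<open>x \<in> X\<close>, \<open>x' \<notin> X\<close> and \<open>y, y' \<in> Y\<close>, and let \<open>t \<mapsto> c t + d\<close> map \<open>x, x'\<close> to \<open>y, y'\<close>.
  By exchange \<open>y\<close> and \<open>y'\<close> are nonalgebraic over \<open>c, d\<close>, so \<open>c X + d\<close> splits \<open>Y\<close> into two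
  infinite pieces.  This descends to \<open>K\<close> because a definable \<open>S\<close> is infinite if and only if
  \<open>(S - S) / (S - S) = K\<close>, which is a first-order condition.  Thus every infinite definable
  set is split by an affine image of \<open>X\<close>, and the formula \<open>z \<in> c X + d\<close> has the order property.
\<close>

section \<open>Substitution of variables\<close>

text \<open>Two coefficients are needed because one point must land inside the image and another
  outside it: a translation alone would force y - x = y' - x', which independent points do not
  satisfy. The coefficients c, d exist only in the extension, so what has to come back to K is the
  statement that some c, d leave both pieces infinite. Infinity is not first-order in general; the
  quotient criterion expresses it uniformly in the parameters. Its two directions serve at different
  ends: infinite implies \<open>spread\<close> in the extension (this needs exchange), and
  \<open>spread\<close> implies infinite in K (by counting).

  A second obstacle is that exchange and stability are assumed for models with universe in
  \<open>'u\<close>, while K may live in an unrelated type. Therefore all extensions are built in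
  \<open>'u\<close>, and K is not embedded: an extension only realises the type of a countable tuple
  of parameters from K together with new points.\<close>

lemma finite_tvars: "finite (tvars t)"
  by (induction t) auto

lemma finite_fv: "finite (fv p)"
  by (induction p) (auto simp: finite_tvars)

text \<open>Strictly above all of A, not merely outside it: the value also bounds the length of a
  list covering the free variables of a formula. It is never 0, which keeps it apart from the
  distinguished variable 0.\<close>

definition fresh :: "nat set \<Rightarrow> nat" where
  "fresh A = Suc (Max (insert 0 A))"

lemma fresh_gr: "finite A \<Longrightarrow> v \<in> A \<Longrightarrow> v < fresh A"
  unfolding fresh_def by (simp add: less_Suc_eq_le)

lemma fresh_notin: "finite A \<Longrightarrow> fresh A \<notin> A"
  using fresh_gr by blast

lemma fresh_pos: "0 < fresh A"
  by (simp add: fresh_def)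

fun tren :: "(nat \<Rightarrow> nat) \<Rightarrow> 'f trm \<Rightarrow> 'f trm" where
  "tren s (Var x) = Var (s x)"
| "tren s (App f ts) = App f (map (tren s) ts)"

text \<open>Renamings need not be injective, since several variables may be sent to one parameter.
  Bound variables are therefore always replaced by one outside the image of the free variables,
  which prevents capture.\<close>

fun ren :: "(nat \<Rightarrow> nat) \<Rightarrow> ('f, 'r) fm \<Rightarrow> ('f, 'r) fm" where
  "ren s (Eq t u) = Eq (tren s t) (tren s u)"
| "ren s (Rel r ts) = Rel r (map (tren s) ts)"
| "ren s (Neg p) = Neg (ren s p)"
| "ren s (And p q) = And (ren s p) (ren s q)"
| "ren s (Exi x p) = (let y = fresh (s ` fv p) in Exi y (ren (s(x := y)) p))"

lemma tval_cong: "(\<And>x. x \<in> tvars t \<Longrightarrow> e x = e' x) \<Longrightarrow> tval M e t = tval M e' t"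
proof (induction t)
  case (App f ts)
  then have "map (tval M e) ts = map (tval M e') ts" by auto
  then show ?case by (simp only: tval.simps)
qed simp

lemma sat_cong: "(\<And>x. x \<in> fv p \<Longrightarrow> e x = e' x) \<Longrightarrow> sat M e p = sat M e' p"
proof (induction p arbitrary: e e')
  case (Eq t u)
  then have "tval M e t = tval M e' t" "tval M e u = tval M e' u"
    by (auto intro!: tval_cong)
  then show ?case by simp
next
  case (Rel r ts)
  then have "map (tval M e) ts = map (tval M e') ts"
    by (auto intro!: tval_cong)
  then show ?case by (simp only: sat.simps)
next
  case (Neg p)
  then show ?case by (metis fv.simps(3) sat.simps(3))
next
  case (And p q)
  then show ?case by (metis UnCI fv.simps(4) sat.simps(4))
next
  case (Exi x p)
  have "sat M (e(x := a)) p = sat M (e'(x := a)) p" for a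
    using Exi.prems by (intro Exi.IH) auto
  then show ?case by simp
qed

lemma is_term_tren [simp]: "is_term L (tren s t) = is_term L t"
  by (induction t) auto

lemma is_formula_ren [simp]: "is_formula L (ren s p) = is_formula L p"
  by (induction p arbitrary: s) (auto simp: Let_def)

lemma tval_tren: "tval M e (tren s t) = tval M (\<lambda>x. e (s x)) t"
proof (induction t)
  case (App f ts)
  then have "map (tval M e \<circ> tren s) ts = map (tval M (\<lambda>x. e (s x))) ts" by auto
  then show ?case by (simp only: tren.simps tval.simps map_map)
qed simp

lemma sat_ren [simp]: "sat M e (ren s p) = sat M (\<lambda>x. e (s x)) p"
proof (induction p arbitrary: e s)
  case (Rel r ts)
  have "map (tval M e \<circ> tren s) ts = map (tval M (\<lambda>x. e (s x))) ts"
    by (auto simp: tval_tren)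
  then show ?case by (simp only: ren.simps sat.simps map_map)
next
  case (Exi x p)
  define y where "y = fresh (s ` fv p)"
  have y: "y \<notin> s ` fv p" unfolding y_def by (intro fresh_notin finite_imageI finite_fv)
  have "sat M (\<lambda>z. (e(y := a)) ((s(x := y)) z)) p = sat M ((\<lambda>z. e (s z))(x := a)) p" for a
    using y by (intro sat_cong) auto
  then show ?case
    unfolding ren.simps Let_def y_def [symmetric] sat.simps Exi.IH by blast
qed (auto simp: tval_tren)

lemma holds_iff_sat:
  assumes "is_sentence L p" "range e \<subseteq> univ M"
  shows "holds M p \<longleftrightarrow> sat M e p"
  using assms sat_cong [of p] unfolding holds_def is_sentence_def by blast

section \<open>Ultraproducts\<close>

text \<open>Zorn's lemma for families with the finite intersection property. In a maximal family, if
  neither A nor its complement belonged to it, each would come with a finite subfamily excluding it,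
  and together these would have empty intersection. The second conclusion says at once that the
  filter is ultra and that it is proper.\<close>

lemma ultrafilter_extension:
  assumes fip: "\<And>F. finite F \<Longrightarrow> F \<subseteq> \<A> \<Longrightarrow> \<Inter>F \<noteq> {}"
  obtains U :: "'i filter" where "\<And>A. A \<in> \<A> \<Longrightarrow> \<forall>\<^sub>F i in U. i \<in> A"
    and "\<And>P. (\<forall>\<^sub>F i in U. \<not> P i) \<longleftrightarrow> \<not> (\<forall>\<^sub>F i in U. P i)"
proof -
  define \<C> where "\<C> = {\<B>. \<A> \<subseteq> \<B> \<and> (\<forall>F. finite F \<longrightarrow> F \<subseteq> \<B> \<longrightarrow> \<Inter>F \<noteq> {})}"
  have "\<exists>\<U>\<in>\<C>. \<forall>\<B>\<in>\<C>. \<U> \<subseteq> \<B> \<longrightarrow> \<B> = \<U>"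
  proof (rule subset_Zorn_nonempty)
    show "\<C> \<noteq> {}" using fip unfolding \<C>_def by blast
    fix C assume C: "C \<noteq> {}" "subset.chain \<C> C"
    have "\<Inter>F \<noteq> {}" if F: "finite F" "F \<subseteq> \<Union>C" for F
    proof -
      obtain \<B> where "\<B> \<in> C" "F \<subseteq> \<B>"
        using finite_subset_Union_chain [OF F C] by blast
      then show ?thesis
        using C(2) F(1) unfolding \<C>_def subset.chain_def by blast
    qed
    then show "\<Union>C \<in> \<C>"
      using C unfolding \<C>_def subset.chain_def by blast
  qed
  then obtain \<U> where \<U>: "\<U> \<in> \<C>" and max: "\<And>\<B>. \<B> \<in> \<C> \<Longrightarrow> \<U> \<subseteq> \<B> \<Longrightarrow> \<B> = \<U>"
    by blast
  have fipU: "\<Inter>F \<noteq> {}" if "finite F" "F \<subseteq> \<U>" for F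
    using \<U> that unfolding \<C>_def by blast
  have addable: "\<exists>F. finite F \<and> F \<subseteq> \<U> \<and> \<Inter>F \<inter> A = {}" if "A \<notin> \<U>" for A
  proof -
    have "insert A \<U> \<notin> \<C>" using max [of "insert A \<U>"] that by blast
    then obtain F where F: "finite F" "F \<subseteq> insert A \<U>" "\<Inter>F = {}"
      using \<U> unfolding \<C>_def by blast
    then have "\<Inter>(F - {A}) \<inter> A = {}" by auto
    with F(1,2) show ?thesis by (intro exI [of _ "F - {A}"]) auto
  qed
  have compl: "- A \<in> \<U> \<longleftrightarrow> A \<notin> \<U>" for A
  proof
    show "A \<notin> \<U>" if "- A \<in> \<U>"
      using fipU [of "{A, - A}"] that by auto
    show "- A \<in> \<U>" if A: "A \<notin> \<U>"
    proof (rule ccontr)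
      assume "- A \<notin> \<U>"
      from addable [OF A] addable [OF this] obtain F G where
        "finite F" "F \<subseteq> \<U>" "\<Inter>F \<inter> A = {}" "finite G" "G \<subseteq> \<U>" "\<Inter>G \<inter> - A = {}"
        by blast
      moreover from this have "\<Inter>(F \<union> G) = {}"
        unfolding Inf_union_distrib by blast
      ultimately show False using fipU [of "F \<union> G"] by auto
    qed
  qed
  have mono: "B \<in> \<U>" if "A \<in> \<U>" "A \<subseteq> B" for A B
    using fipU [of "{A, - B}"] that compl [of B] by auto
  have inter: "A \<inter> B \<in> \<U>" if "A \<in> \<U>" "B \<in> \<U>" for A B
    using fipU [of "{A, B, - (A \<inter> B)}"] that compl [of "A \<inter> B"] by auto
  have univ: "UNIV \<in> \<U>"
    using fipU [of "{{}}"] compl [of UNIV] by auto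
  define U where "U = Abs_filter (\<lambda>P. {i. P i} \<in> \<U>)"
  have "is_filter (\<lambda>P. {i. P i} \<in> \<U>)"
  proof
    show "{i. P i \<and> Q i} \<in> \<U>" if "{i. P i} \<in> \<U>" "{i. Q i} \<in> \<U>" for P Q
      using inter [OF that] by (simp add: Collect_conj_eq)
    show "{i. Q i} \<in> \<U>" if "\<forall>i. P i \<longrightarrow> Q i" "{i. P i} \<in> \<U>" for P Q
      using mono [OF that(2)] that(1) by blast
  qed (use univ in simp)
  then have ev: "(\<forall>\<^sub>F i in U. P i) \<longleftrightarrow> {i. P i} \<in> \<U>" for P
    unfolding U_def by (rule eventually_Abs_filter)
  show thesis
  proof
    show "\<forall>\<^sub>F i in U. i \<in> A" if "A \<in> \<A>" for A
      using \<U> that unfolding \<C>_def ev by auto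
    show "(\<forall>\<^sub>F i in U. \<not> P i) \<longleftrightarrow> \<not> (\<forall>\<^sub>F i in U. P i)" for P
      using compl [of "{i. P i}"] unfolding ev by (simp add: Collect_neg_eq)
  qed
qed

text \<open>
  Satisfaction interprets \<^const>\<open>Eq\<close> by equality, so the universe consists of one
  representative from each class of sequences that agree almost everywhere.
\<close>

definition ultra_rep :: "'i filter \<Rightarrow> ('i \<Rightarrow> 'u set) \<Rightarrow> ('i \<Rightarrow> 'u) \<Rightarrow> ('i \<Rightarrow> 'u)" where
  "ultra_rep U A g = (SOME h. (\<forall>i. h i \<in> A i) \<and> (\<forall>\<^sub>F i in U. h i = g i))"

definition ultraproduct :: "'i filter \<Rightarrow> ('i \<Rightarrow> ('f, 'r, 'u) struc) \<Rightarrow> ('f, 'r, 'i \<Rightarrow> 'u) struc" where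
  "ultraproduct U M =
     \<lparr>univ = ultra_rep U (\<lambda>i. univ (M i)) ` {g. \<forall>i. g i \<in> univ (M i)},
      fint = (\<lambda>f as. ultra_rep U (\<lambda>i. univ (M i)) (\<lambda>i. fint (M i) f (map (\<lambda>h. h i) as))),
      rint = (\<lambda>r as. \<forall>\<^sub>F i in U. rint (M i) r (map (\<lambda>h. h i) as))\<rparr>"

lemma ultra_rep:
  assumes "\<forall>i. g i \<in> A i"
  shows "ultra_rep U A g i \<in> A i" "\<forall>\<^sub>F i in U. ultra_rep U A g i = g i"
proof -
  have "\<exists>h. (\<forall>i. h i \<in> A i) \<and> (\<forall>\<^sub>F i in U. h i = g i)"
    using assms by (intro exI [of _ g]) auto
  from someI_ex [OF this, folded ultra_rep_def]
  show "ultra_rep U A g i \<in> A i" "\<forall>\<^sub>F i in U. ultra_rep U A g i = g i" by auto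
qed

lemma ultra_rep_cong:
  assumes "\<forall>\<^sub>F i in U. g i = g' i"
  shows "ultra_rep U A g = ultra_rep U A g'"
proof -
  have "(\<forall>\<^sub>F i in U. h i = g i) \<longleftrightarrow> (\<forall>\<^sub>F i in U. h i = g' i)" for h
    by (rule eventually_subst, use assms in eventually_elim) simp
  then show ?thesis unfolding ultra_rep_def by simp
qed

context
  fixes U :: "'i filter" and M :: "'i \<Rightarrow> ('f, 'r, 'u) struc" and L :: "('f, 'r) lang"
  assumes ultra: "\<And>P. (\<forall>\<^sub>F i in U. \<not> P i) \<longleftrightarrow> \<not> (\<forall>\<^sub>F i in U. P i)"
    and struc: "\<And>i. is_struc L (M i)"
begin

lemma ultraproduct_univD: "h \<in> univ (ultraproduct U M) \<Longrightarrow> h i \<in> univ (M i)"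
  unfolding ultraproduct_def by (auto intro: ultra_rep(1) [where A = "\<lambda>i. univ (M i)"])

lemma ultraproduct_eq_iff:
  assumes "h \<in> univ (ultraproduct U M)" "h' \<in> univ (ultraproduct U M)"
  shows "h = h' \<longleftrightarrow> (\<forall>\<^sub>F i in U. h i = h' i)"
proof
  assume *: "\<forall>\<^sub>F i in U. h i = h' i"
  from assms obtain g g' where g: "\<forall>i. g i \<in> univ (M i)" "\<forall>i. g' i \<in> univ (M i)"
    "h = ultra_rep U (\<lambda>i. univ (M i)) g" "h' = ultra_rep U (\<lambda>i. univ (M i)) g'"
    unfolding ultraproduct_def by auto
  then have "\<forall>\<^sub>F i in U. h i = g i" "\<forall>\<^sub>F i in U. h' i = g' i"
    by (auto intro: ultra_rep(2) [where A = "\<lambda>i. univ (M i)"])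
  with * have "\<forall>\<^sub>F i in U. g i = g' i" by eventually_elim simp
  with g show "h = h'" using ultra_rep_cong by blast
qed simp

lemma ultraproduct_fint:
  assumes "f \<in> Funs L" "length as = farity L f" "set as \<subseteq> univ (ultraproduct U M)"
  shows "fint (ultraproduct U M) f as \<in> univ (ultraproduct U M)"
    and "\<forall>\<^sub>F i in U. fint (ultraproduct U M) f as i = fint (M i) f (map (\<lambda>h. h i) as)"
proof -
  have "set (map (\<lambda>h. h i) as) \<subseteq> univ (M i)" for i
    using assms ultraproduct_univD [of _ i] by auto
  then have "fint (M i) f (map (\<lambda>h. h i) as) \<in> univ (M i)" for i
    using struc [of i] assms unfolding is_struc_def by simp
  then show "fint (ultraproduct U M) f as \<in> univ (ultraproduct U M)"
    "\<forall>\<^sub>F i in U. fint (ultraproduct U M) f as i = fint (M i) f (map (\<lambda>h. h i) as)"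
    unfolding ultraproduct_def by (auto intro: ultra_rep(2) [where A = "\<lambda>i. univ (M i)"])
qed

lemma is_struc_ultraproduct: "is_struc L (ultraproduct U M)"
proof -
  have "\<forall>i. (SOME a. a \<in> univ (M i)) \<in> univ (M i)"
    using struc unfolding is_struc_def by (simp add: some_in_eq)
  then have "univ (ultraproduct U M) \<noteq> {}"
    unfolding ultraproduct_def by auto
  then show ?thesis
    unfolding is_struc_def using ultraproduct_fint(1) by auto
qed

lemma eventually_list_all:
  "(\<And>x. x \<in> set xs \<Longrightarrow> \<forall>\<^sub>F i in U. P i x) \<Longrightarrow> \<forall>\<^sub>F i in U. \<forall>x\<in>set xs. P i x"
  by (simp add: eventually_ball_finite)

lemma tval_ultraproduct:
  assumes e: "range e \<subseteq> univ (ultraproduct U M)"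
  shows "is_term L t \<Longrightarrow> tval (ultraproduct U M) e t \<in> univ (ultraproduct U M) \<and>
    (\<forall>\<^sub>F i in U. tval (ultraproduct U M) e t i = tval (M i) (\<lambda>x. e x i) t)"
proof (induction t)
  case (App f ts)
  let ?W = "ultraproduct U M" and ?as = "map (tval (ultraproduct U M) e) ts"
  have as: "f \<in> Funs L" "length ?as = farity L f" "set ?as \<subseteq> univ ?W"
    using App by auto
  have "\<forall>\<^sub>F i in U. \<forall>t\<in>set ts. tval ?W e t i = tval (M i) (\<lambda>x. e x i) t"
    using App by (intro eventually_list_all) auto
  with ultraproduct_fint(2) [OF as]
  have "\<forall>\<^sub>F i in U. tval ?W e (App f ts) i = tval (M i) (\<lambda>x. e x i) (App f ts)"
    by eventually_elim (auto intro!: arg_cong [where f = "fint _ _"])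
  then show ?case using ultraproduct_fint(1) [OF as] by simp
qed (use e in auto)

theorem los_ultraproduct:
  "is_formula L p \<Longrightarrow> range e \<subseteq> univ (ultraproduct U M) \<Longrightarrow>
   sat (ultraproduct U M) e p \<longleftrightarrow> (\<forall>\<^sub>F i in U. sat (M i) (\<lambda>x. e x i) p)"
proof (induction p arbitrary: e)
  case (Eq s t)
  let ?W = "ultraproduct U M"
  have s: "tval ?W e s \<in> univ ?W" "\<forall>\<^sub>F i in U. tval ?W e s i = tval (M i) (\<lambda>x. e x i) s"
    and t: "tval ?W e t \<in> univ ?W" "\<forall>\<^sub>F i in U. tval ?W e t i = tval (M i) (\<lambda>x. e x i) t"
    using Eq tval_ultraproduct by auto
  have "(\<forall>\<^sub>F i in U. tval ?W e s i = tval ?W e t i) \<longleftrightarrow>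
    (\<forall>\<^sub>F i in U. tval (M i) (\<lambda>x. e x i) s = tval (M i) (\<lambda>x. e x i) t)"
    by (rule eventually_subst, use s(2) t(2) in eventually_elim) simp
  then show ?case using ultraproduct_eq_iff [OF s(1) t(1)] by simp
next
  case (Rel r ts)
  let ?W = "ultraproduct U M"
  have "\<forall>\<^sub>F i in U. \<forall>t\<in>set ts. tval ?W e t i = tval (M i) (\<lambda>x. e x i) t"
    using Rel tval_ultraproduct by (intro eventually_list_all) auto
  then have "\<forall>\<^sub>F i in U. map (\<lambda>h. h i) (map (tval ?W e) ts) = map (tval (M i) (\<lambda>x. e x i)) ts"
    by eventually_elim auto
  then have "(\<forall>\<^sub>F i in U. rint (M i) r (map (\<lambda>h. h i) (map (tval ?W e) ts))) \<longleftrightarrow>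
    (\<forall>\<^sub>F i in U. rint (M i) r (map (tval (M i) (\<lambda>x. e x i)) ts))"
    by (intro eventually_subst, eventually_elim) (simp only:)
  then show ?case by (simp add: ultraproduct_def)
next
  case (Neg p)
  then show ?case by (simp add: ultra)
next
  case (And p q)
  then show ?case by (simp add: eventually_conj_iff)
next
  case (Exi x p)
  let ?W = "ultraproduct U M"
  have upd: "sat ?W (e(x := h)) p \<longleftrightarrow> (\<forall>\<^sub>F i in U. sat (M i) ((\<lambda>y. e y i)(x := h i)) p)"
    if "h \<in> univ ?W" for h
  proof -
    have "(\<lambda>y. (e(x := h)) y i) = (\<lambda>y. e y i)(x := h i)" for i by auto
    moreover have "range (e(x := h)) \<subseteq> univ ?W" using Exi.prems that by auto
    ultimately show ?thesis
      using Exi.IH [where e = "e(x := h)"] Exi.prems(1) by (simp only: is_formula.simps)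
  qed
  show ?case
  proof
    assume "sat ?W e (Exi x p)"
    then obtain h where h: "h \<in> univ ?W" "sat ?W (e(x := h)) p" by auto
    from upd [OF h(1)] h(2) have "\<forall>\<^sub>F i in U. sat (M i) ((\<lambda>y. e y i)(x := h i)) p" by simp
    then show "\<forall>\<^sub>F i in U. sat (M i) (\<lambda>y. e y i) (Exi x p)"
      by eventually_elim (use ultraproduct_univD [OF h(1)] in auto)
  next
    assume ev: "\<forall>\<^sub>F i in U. sat (M i) (\<lambda>y. e y i) (Exi x p)"
    \<comment> \<open>At coordinates without a witness any element is taken; these coordinates are
      negligible for \<open>U\<close>.\<close>
    have "\<exists>a. a \<in> univ (M i) \<and>
      (sat (M i) (\<lambda>y. e y i) (Exi x p) \<longrightarrow> sat (M i) ((\<lambda>y. e y i)(x := a)) p)" for i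
      using struc [of i] unfolding is_struc_def
      by (cases "sat (M i) (\<lambda>y. e y i) (Exi x p)") auto
    then obtain g where g: "\<And>i. g i \<in> univ (M i)"
      "\<And>i. sat (M i) (\<lambda>y. e y i) (Exi x p) \<Longrightarrow> sat (M i) ((\<lambda>y. e y i)(x := g i)) p"
      by metis
    define h where "h = ultra_rep U (\<lambda>i. univ (M i)) g"
    have h: "h \<in> univ ?W" unfolding h_def ultraproduct_def using g(1) by auto
    have "\<forall>\<^sub>F i in U. h i = g i" unfolding h_def using g(1) by (intro ultra_rep(2)) auto
    with ev have "\<forall>\<^sub>F i in U. sat (M i) ((\<lambda>y. e y i)(x := h i)) p"
      by eventually_elim (use g(2) in simp)
    with upd [OF h] h show "sat ?W e (Exi x p)" by auto
  qed
qed

end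


section \<open>Loewenheim--Skolem and compactness\<close>

lemma times_lepoll_infinite:
  assumes "infinite K" "A \<lesssim> K" "B \<lesssim> K"
  shows "A \<times> B \<lesssim> K"
proof -
  have "K \<times> K \<approx> K"
    unfolding eqpoll_iff_card_of_ordIso using assms(1) by (rule card_of_Times_same_infinite)
  then show ?thesis
    using times_lepoll_mono [OF assms(2,3)] by (rule lepoll_trans2 [rotated])
qed

lemma UN_nat_lepoll_infinite:
  assumes "infinite K" "\<And>n :: nat. C n \<lesssim> K"
  shows "(\<Union>n. C n) \<lesssim> K"
proof -
  obtain g where "\<And>n. C n \<subseteq> g n ` K"
    using assms(2) unfolding lepoll_iff by metis
  then have "(\<Union>n. C n) \<subseteq> (\<lambda>(n, a). g n a) ` (UNIV \<times> K)" by fastforce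
  then have "(\<Union>n. C n) \<lesssim> (UNIV :: nat set) \<times> K" by (rule subset_image_lepoll)
  also have "\<dots> \<lesssim> K"
    using assms(1) infinite_le_lepoll by (intro times_lepoll_infinite) auto
  finally show ?thesis .
qed

lemma Un_lepoll_infinite:
  assumes "infinite K" "A \<lesssim> K" "B \<lesssim> K"
  shows "A \<union> B \<lesssim> K"
proof -
  have "(\<Union>n::nat. if n = 0 then A else B) \<lesssim> K"
    using assms by (intro UN_nat_lepoll_infinite) auto
  moreover have "A \<union> B \<subseteq> (\<Union>n::nat. if n = 0 then A else B)"
    using UN_upper [of "0::nat" UNIV "\<lambda>n. if n = 0 then A else B"]
      UN_upper [of "1::nat" UNIV "\<lambda>n. if n = 0 then A else B"] by simp
  ultimately show ?thesis using lepoll_trans subset_imp_lepoll by blast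
qed

lemma lists_lepoll_infinite:
  assumes "infinite K"
  shows "lists K \<lesssim> K"
proof -
  have "{xs \<in> lists K. length xs = n} \<lesssim> K" for n
  proof (induction n)
    case 0
    have "{xs \<in> lists K. length xs = 0} = {[]}" by auto
    then show ?case using assms by (simp add: finite_lepoll_infinite)
  next
    case (Suc n)
    have "{xs \<in> lists K. length xs = Suc n} \<subseteq>
        (\<lambda>(x, xs). x # xs) ` (K \<times> {xs \<in> lists K. length xs = n})"
      by (auto simp: length_Suc_conv image_iff)
    then have "{xs \<in> lists K. length xs = Suc n} \<lesssim> K \<times> {xs \<in> lists K. length xs = n}"
      by (rule subset_image_lepoll)
    also have "\<dots> \<lesssim> K" using assms Suc by (intro times_lepoll_infinite) auto
    finally show ?case .
  qed
  then have "(\<Union>n. {xs \<in> lists K. length xs = n}) \<lesssim> K"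
    by (intro UN_nat_lepoll_infinite assms)
  moreover have "(\<Union>n. {xs \<in> lists K. length xs = n}) = lists K" by auto
  ultimately show ?thesis by simp
qed

lemma infinite_formulas: "infinite {p. is_formula L p}"
proof -
  have "inj (\<lambda>i. Eq (Var i) (Var i))" by (auto intro: injI)
  then have "infinite (range (\<lambda>i. Eq (Var i) (Var i)))" by (rule range_inj_infinite)
  then show ?thesis by (rule infinite_super [rotated]) auto
qed

text \<open>The last conclusion is the Tarski-Vaught condition. Parameters of a formula enter as
  finite lists, so each stage adds at most as many elements as there are triples of a formula, a
  variable and a list over the previous stage, and that is no more than the number of
  formulas.\<close>

lemma skolem_hull:
  fixes L :: "('f, 'r) lang" and W :: "('f, 'r, 'w) struc" and e :: "nat \<Rightarrow> 'w"
  assumes e: "range e \<subseteq> univ W"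
  obtains H where "range e \<subseteq> H" "H \<subseteq> univ W" "H \<lesssim> {p. is_formula L p}"
    and "\<And>p x f. is_formula L p \<Longrightarrow> range f \<subseteq> H \<Longrightarrow>
      \<exists>a\<in>univ W. sat W (f(x := a)) p \<Longrightarrow> \<exists>a\<in>H. sat W (f(x := a)) p"
proof -
  let ?Fm = "{p. is_formula L p}"
  \<comment> \<open>A list codes an assignment; positions beyond its end get the filler
    \<open>e 0\<close>. The list chosen for the last conclusion is long enough to cover every free
    variable.\<close>
  define asg where "asg = (\<lambda>as i. if i < length as then as ! i else e 0)"
  define sk where "sk = (\<lambda>(p, x, as). if \<exists>a\<in>univ W. sat W ((asg as)(x := a)) p
    then SOME a. a \<in> univ W \<and> sat W ((asg as)(x := a)) p else e 0)"
  have sk_univ: "sk t \<in> univ W" for t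
  proof (cases t)
    case (fields p x as)
    show ?thesis
    proof (cases "\<exists>a\<in>univ W. sat W ((asg as)(x := a)) p")
      case True
      then have "\<exists>a. a \<in> univ W \<and> sat W ((asg as)(x := a)) p" by blast
      from someI_ex [OF this] show ?thesis using True fields unfolding sk_def by simp
    next
      case False
      then show ?thesis using fields e unfolding sk_def by auto
    qed
  qed
  have sk_sat: "sat W ((asg as)(x := sk (p, x, as))) p" if "\<exists>a\<in>univ W. sat W ((asg as)(x := a)) p"
    for p x as
  proof -
    from that have "\<exists>a. a \<in> univ W \<and> sat W ((asg as)(x := a)) p" by blast
    from someI_ex [OF this] show ?thesis using that unfolding sk_def by simp
  qed
  define H where "H = rec_nat (range e) (\<lambda>_ H. H \<union> sk ` (?Fm \<times> UNIV \<times> lists H))"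
  have H0: "H 0 = range e" and HS: "H (Suc n) = H n \<union> sk ` (?Fm \<times> UNIV \<times> lists (H n))" for n
    unfolding H_def by simp_all
  have mono: "mono H"
    unfolding mono_iff_le_Suc using HS by blast
  have sub: "H n \<subseteq> univ W" for n
    by (induction n) (use e sk_univ in \<open>auto simp: H0 HS\<close>)
  have nat_Fm: "(UNIV :: nat set) \<lesssim> ?Fm"
    using infinite_formulas infinite_le_lepoll by blast
  have small: "H n \<lesssim> ?Fm" for n
  proof (induction n)
    case 0
    have "range e \<lesssim> (UNIV :: nat set)" by (rule image_lepoll)
    then show ?case using nat_Fm lepoll_trans unfolding H0 by blast
  next
    case (Suc n)
    have "lists (H n) \<lesssim> lists ?Fm" using Suc by (rule lists_lepoll_mono)
    also have "\<dots> \<lesssim> ?Fm" by (rule lists_lepoll_infinite [OF infinite_formulas])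
    finally have "?Fm \<times> (UNIV :: nat set) \<times> lists (H n) \<lesssim> ?Fm"
      by (intro times_lepoll_infinite infinite_formulas lepoll_refl nat_Fm)
    then have "sk ` (?Fm \<times> UNIV \<times> lists (H n)) \<lesssim> ?Fm"
      using image_lepoll lepoll_trans by blast
    then show ?case
      unfolding HS using Suc by (intro Un_lepoll_infinite infinite_formulas)
  qed
  show thesis
  proof
    show "range e \<subseteq> (\<Union>n. H n)" using H0 by blast
    show "(\<Union>n. H n) \<subseteq> univ W" using sub by blast
    show "(\<Union>n. H n) \<lesssim> ?Fm" by (intro UN_nat_lepoll_infinite infinite_formulas small)
    fix p x f
    assume p: "is_formula L p" and f: "range f \<subseteq> (\<Union>n. H n)"
      and ex: "\<exists>a\<in>univ W. sat W (f(x := a)) p"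
    define as where "as = map f [0..<fresh (fv p)]"
    have agree: "asg as v = f v" if "v \<in> fv p" for v
      using fresh_gr [OF finite_fv that] unfolding asg_def as_def by simp
    then have eq: "sat W ((asg as)(x := a)) p = sat W (f(x := a)) p" for a
      by (intro sat_cong) simp
    have "\<exists>n. f ` {0..<m} \<subseteq> H n" for m
    proof (induction m)
      case (Suc m)
      then obtain n where "f ` {0..<m} \<subseteq> H n" by blast
      moreover have "f m \<in> (\<Union>n. H n)" using f by (rule range_subsetD)
      then obtain n' where "f m \<in> H n'" by blast
      moreover have "H n \<subseteq> H (max n n')" "H n' \<subseteq> H (max n n')"
        by (auto intro: monoD [OF mono, THEN subsetD, rotated])
      ultimately have "f ` {0..<Suc m} \<subseteq> H (max n n')"
        unfolding atLeast0_lessThan_Suc image_insert by blast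
      then show ?case by blast
    qed auto
    then obtain n where "as \<in> lists (H n)" unfolding as_def by fastforce
    then have "sk (p, x, as) \<in> H (Suc n)" using p HS by blast
    moreover have "sat W (f(x := sk (p, x, as))) p"
      using sk_sat [of as x p] ex unfolding eq by blast
    ultimately show "\<exists>a\<in>\<Union>n. H n. sat W (f(x := a)) p" by blast
  qed
qed

text \<open>Substitute for an elementary embedding: two countable tuples have the same complete
  type. The structures may live in different types, and nothing is claimed about elements outside
  the two tuples.\<close>

definition elem_equiv ::
    "('f, 'r) lang \<Rightarrow> ('f, 'r, 'v) struc \<Rightarrow> (nat \<Rightarrow> 'v) \<Rightarrow> ('f, 'r, 'w) struc \<Rightarrow> (nat \<Rightarrow> 'w) \<Rightarrow> bool" where
  "elem_equiv L M e N f \<longleftrightarrow> (\<forall>p. is_formula L p \<longrightarrow> sat M e p = sat N f p)"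

lemma elem_equivD: "elem_equiv L M e N f \<Longrightarrow> is_formula L p \<Longrightarrow> sat M e p = sat N f p"
  unfolding elem_equiv_def by blast

lemma elem_equiv_trans:
  "elem_equiv L M e N f \<Longrightarrow> elem_equiv L N f K g \<Longrightarrow> elem_equiv L M e K g"
  unfolding elem_equiv_def by blast

lemma elem_equiv_comp:
  assumes "elem_equiv L M e N f"
  shows "elem_equiv L M (\<lambda>x. e (s x)) N (\<lambda>x. f (s x))"
  using assms unfolding elem_equiv_def by (metis is_formula_ren sat_ren)

lemma elem_equiv_model:
  assumes "elem_equiv L M e N f" "is_theory L T" "is_model L T M" "is_struc L N"
    "range e \<subseteq> univ M" "range f \<subseteq> univ N"
  shows "is_model L T N"
proof -
  have "holds N p" if p: "p \<in> T" for p
  proof -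
    have s: "is_sentence L p" using assms(2) p unfolding is_theory_def by blast
    have "holds M p" using assms(3) p unfolding is_model_def by blast
    then have "sat M e p" using assms(5) unfolding holds_def by blast
    then have "sat N f p"
      using elem_equivD [OF assms(1)] s unfolding is_sentence_def by blast
    then show ?thesis using holds_iff_sat [OF s assms(6)] by simp
  qed
  then show ?thesis using assms(4) unfolding is_model_def by blast
qed

lemma downward_loewenheim_skolem:
  fixes L :: "('f, 'r) lang" and W :: "('f, 'r, 'w) struc"
  assumes large: "large_for TYPE('u) L" and W: "is_struc L W" and e: "range e \<subseteq> univ W"
  obtains N :: "('f, 'r, 'u) struc" and g where "is_struc L N" "range g \<subseteq> univ N"
    "elem_equiv L W e N g"
proof -
  obtain H where H: "range e \<subseteq> H" "H \<subseteq> univ W" "H \<lesssim> {p. is_formula L p}"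
    and tv: "\<And>p x f. is_formula L p \<Longrightarrow> range f \<subseteq> H \<Longrightarrow>
      \<exists>a\<in>univ W. sat W (f(x := a)) p \<Longrightarrow> \<exists>a\<in>H. sat W (f(x := a)) p"
    using skolem_hull [OF e] by metis
  have "H \<lesssim> (UNIV :: 'u set)"
    using H(3) large lepoll_trans unfolding large_for_def by blast
  then obtain h :: "'w \<Rightarrow> 'u" where h: "inj_on h H" unfolding lepoll_def by blast
  define N :: "('f, 'r, 'u) struc" where
    "N = \<lparr>univ = h ` H, fint = (\<lambda>f as. h (fint W f (map (inv_into H h) as))),
      rint = (\<lambda>r as. rint W r (map (inv_into H h) as))\<rparr>"
  have inv: "map (inv_into H h) (map h as) = as" if "set as \<subseteq> H" for as
    using that h by (induction as) auto
  have closed: "fint W f as \<in> H" if f: "f \<in> Funs L" "length as = farity L f" "set as \<subseteq> H" for f as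
  proof -
    \<comment> \<open>The hull is known to contain witnesses, not function values; this formula
      turns the value of f into a witness.\<close>
    let ?p = "Eq (Var (length as)) (App f (map Var [0..<length as]))"
    define k where "k = (\<lambda>i. if i < length as then as ! i else e 0)"
    have "k i \<in> H" for i using f(3) H(1) nth_mem [of i as] unfolding k_def by auto
    then have k: "range k \<subseteq> H" by blast
    have "map (tval W (k(length as := a))) (map Var [0..<length as]) = as" for a
      by (rule nth_equalityI) (auto simp: k_def)
    then have sat: "sat W (k(length as := a)) ?p \<longleftrightarrow> a = fint W f as" for a
      by (simp only: sat.simps tval.simps fun_upd_same)
    have "fint W f as \<in> univ W" using W f H(2) unfolding is_struc_def by auto
    then have "\<exists>a\<in>univ W. sat W (k(length as := a)) ?p" using sat by blast
    from tv [OF _ k this] show ?thesis using sat f by auto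
  qed
  have tval: "tval W k t \<in> H \<and> tval N (\<lambda>x. h (k x)) t = h (tval W k t)"
    if k: "range k \<subseteq> H" and t: "is_term L t" for k t
    using t
  proof (induction t)
    case (App f ts)
    then have *: "set (map (tval W k) ts) \<subseteq> H"
      and "map (tval N (\<lambda>x. h (k x))) ts = map h (map (tval W k) ts)" by auto
    then have "tval N (\<lambda>x. h (k x)) (App f ts) = h (tval W k (App f ts))"
      using inv [OF *] by (simp add: N_def del: map_map)
    moreover have "tval W k (App f ts) \<in> H" using closed [of f, OF _ _ *] App.prems by simp
    ultimately show ?case by blast
  qed (use k in auto)
  have sat: "is_formula L p \<Longrightarrow> range k \<subseteq> H \<Longrightarrow> sat N (\<lambda>x. h (k x)) p = sat W k p" for k p
  proof (induction p arbitrary: k)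
    case (Eq s t)
    then show ?case using tval [of k s] tval [of k t] h by (auto dest: inj_onD)
  next
    case (Rel r ts)
    then have *: "set (map (tval W k) ts) \<subseteq> H"
      and **: "map (tval N (\<lambda>x. h (k x))) ts = map h (map (tval W k) ts)" using tval by auto
    show ?case unfolding sat.simps ** by (simp add: N_def inv [OF *] del: map_map)
  next
    case (Exi x p)
    have "(\<lambda>y. h (k y))(x := h a) = (\<lambda>y. h ((k(x := a)) y))" for a by auto
    moreover have "range (k(x := a)) \<subseteq> H" if "a \<in> H" for a using Exi.prems(2) that by auto
    ultimately have upd: "sat N ((\<lambda>y. h (k y))(x := h a)) p = sat W (k(x := a)) p" if "a \<in> H" for a
      using Exi.IH [of "k(x := a)"] Exi.prems(1) that by (simp only: is_formula.simps)
    have "univ N = h ` H" by (simp add: N_def)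
    with upd have "sat N (\<lambda>y. h (k y)) (Exi x p) \<longleftrightarrow> (\<exists>a\<in>H. sat W (k(x := a)) p)"
      unfolding sat.simps by (simp only: bex_simps(7) cong: bex_cong)
    then show ?case using tv [of p k x] Exi.prems H(2) unfolding sat.simps by auto
  qed auto
  show thesis
  proof
    show "is_struc L N"
      unfolding is_struc_def
    proof (intro conjI ballI allI impI)
      show "univ N \<noteq> {}" using H(1) by (auto simp: N_def)
      fix f as assume f: "f \<in> Funs L" and as: "set as \<subseteq> univ N \<and> length as = farity L f"
      have "set (map (inv_into H h) as) \<subseteq> H"
        using as by (auto simp: N_def intro: inv_into_into)
      then show "fint N f as \<in> univ N"
        using closed [OF f] as by (auto simp: N_def)
    qed
    show "range (\<lambda>x. h (e x)) \<subseteq> univ N" using H(1) by (auto simp: N_def)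
    show "elem_equiv L W e N (\<lambda>x. h (e x))"
      unfolding elem_equiv_def using sat H(1) by blast
  qed
qed

text \<open>Assignments belong to the data, so \<Sigma> may have free variables and the result
  realises types. The ultraproduct of the structures for the finite subsets, along an ultrafilter
  containing every \<open>cone p\<close>, satisfies \<Sigma> by the theorem of Los. Its elements are
  functions, so Loewenheim-Skolem is needed to return to \<open>'u\<close>.\<close>

theorem compactness:
  fixes L :: "('f, 'r) lang"
  assumes large: "large_for TYPE('u) L" and \<Sigma>: "\<And>p. p \<in> \<Sigma> \<Longrightarrow> is_formula L p"
    and fin: "\<And>F. finite F \<Longrightarrow> F \<subseteq> \<Sigma> \<Longrightarrow>
      \<exists>(M :: ('f, 'r, 'v) struc) e. is_struc L M \<and> range e \<subseteq> univ M \<and> (\<forall>p\<in>F. sat M e p)"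
  obtains N :: "('f, 'r, 'u) struc" and g where "is_struc L N" "range g \<subseteq> univ N"
    "\<And>p. p \<in> \<Sigma> \<Longrightarrow> sat N g p"
proof -
  define ok where "ok = (\<lambda>F. finite F \<and> F \<subseteq> \<Sigma>)"
  have "\<exists>(M :: ('f, 'r, 'v) struc) e. is_struc L M \<and> range e \<subseteq> univ M \<and>
      (ok F \<longrightarrow> (\<forall>p\<in>F. sat M e p))" for F
    using fin [of F] fin [of "{}"] unfolding ok_def by (cases "ok F") (auto simp: ok_def)
  then obtain M :: "('f, 'r) fm set \<Rightarrow> ('f, 'r, 'v) struc" and e where
    M: "\<And>F. is_struc L (M F)" and e: "\<And>F. range (e F) \<subseteq> univ (M F)"
    and sat: "\<And>F p. ok F \<Longrightarrow> p \<in> F \<Longrightarrow> sat (M F) (e F) p"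
    by metis
  define cone where "cone = (\<lambda>p. {F. p \<in> F \<and> ok F})"
  have "\<Inter>G \<noteq> {}" if G: "finite G" "G \<subseteq> cone ` \<Sigma>" for G
  proof -
    from finite_subset_image [OF G] obtain P where P: "P \<subseteq> \<Sigma>" "finite P" "G = cone ` P" by blast
    then have "P \<in> \<Inter>G" unfolding cone_def ok_def by auto
    then show ?thesis by blast
  qed
  then obtain U where U: "\<And>A. A \<in> cone ` \<Sigma> \<Longrightarrow> \<forall>\<^sub>F F in U. F \<in> A"
    and ultra: "\<And>P. (\<forall>\<^sub>F F in U. \<not> P F) \<longleftrightarrow> \<not> (\<forall>\<^sub>F F in U. P F)"
    using ultrafilter_extension by metis
  define W where "W = ultraproduct U M"
  define w where "w = (\<lambda>x. ultra_rep U (\<lambda>F. univ (M F)) (\<lambda>F. e F x))"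
  have ex: "\<forall>F. e F x \<in> univ (M F)" for x using e by blast
  have w: "range w \<subseteq> univ W" unfolding w_def W_def ultraproduct_def using ex by auto
  have W: "is_struc L W" unfolding W_def by (rule is_struc_ultraproduct [OF ultra M])
  have wsat: "sat W w p" if p: "p \<in> \<Sigma>" for p
  proof -
    have "\<forall>\<^sub>F F in U. \<forall>x\<in>fv p. w x F = e F x"
      unfolding w_def by (intro eventually_ball_finite finite_fv ballI ultra_rep(2) ex)
    moreover have "\<forall>\<^sub>F F in U. F \<in> cone p" using U p by blast
    ultimately have "\<forall>\<^sub>F F in U. sat (M F) (\<lambda>x. w x F) p"
    proof eventually_elim
      case (elim F)
      then have "sat (M F) (e F) p" using sat unfolding cone_def by blast
      then show ?case using elim sat_cong [of p "\<lambda>x. w x F" "e F"] by blast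
    qed
    then show ?thesis
      unfolding W_def using los_ultraproduct [OF ultra M \<Sigma> [OF p] w [unfolded W_def]] by simp
  qed
  obtain N :: "('f, 'r, 'u) struc" and g where
    "is_struc L N" "range g \<subseteq> univ N" "elem_equiv L W w N g"
    using downward_loewenheim_skolem [OF large W w] by metis
  with wsat \<Sigma> that show thesis unfolding elem_equiv_def by blast
qed

section \<open>Algebraic closure and independent extensions\<close>

text \<open>Counts the values of variable 0 by deleting one element at a time. The deleted element
  need not be a solution, which makes the bound "at most" and not "exactly".\<close>

fun atmost :: "nat \<Rightarrow> ('f, 'r) fm \<Rightarrow> ('f, 'r) fm" where
  "atmost 0 p = Neg (Exi 0 p)"
| "atmost (Suc n) p =
    (let m = fresh (fv p) in Exi m (atmost n (And p (Neg (Eq (Var 0) (Var m))))))"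

text \<open>
  Definable sets are normalised so that variable \<open>0\<close> ranges over the set and
  variable \<open>Suc v\<close> denotes the parameter \<open>e v\<close>.
\<close>

definition solutions :: "('f, 'r, 'u) struc \<Rightarrow> (nat \<Rightarrow> 'u) \<Rightarrow> ('f, 'r) fm \<Rightarrow> 'u set" where
  "solutions M e p = {a \<in> univ M. sat M (case_nat a e) p}"

lemma case_nat_upd_0 [simp]: "(case_nat b e)(0 := a) = case_nat a e"
  by (auto split: nat.split)

lemma is_formula_atmost [simp]: "is_formula L (atmost n p) = is_formula L p"
  by (induction n arbitrary: p) (auto simp: Let_def)

lemma sat_atmost:
  fixes M :: "('f, 'r, 'a) struc"
  assumes "univ M \<noteq> {}"
  shows "sat M e (atmost n p) \<longleftrightarrow> finite {a \<in> univ M. sat M (e(0 := a)) p} \<and>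
    card {a \<in> univ M. sat M (e(0 := a)) p} \<le> n"
proof (induction n arbitrary: p e)
  case 0
  have "finite S \<and> card S \<le> 0 \<longleftrightarrow> S = {}" for S :: "'a set" by auto
  then show ?case by (simp only: atmost.simps sat.simps) blast
next
  case (Suc n)
  define m where "m = fresh (fv p)"
  have m: "m \<notin> fv p" "m \<noteq> 0"
    unfolding m_def using fresh_notin [OF finite_fv] fresh_pos by auto
  define S where "S = {a \<in> univ M. sat M (e(0 := a)) p}"
  have "sat M (e(m := b, 0 := a)) p = sat M (e(0 := a)) p" for a b
    using m by (intro sat_cong) auto
  then have "{a \<in> univ M. sat M (e(m := b, 0 := a)) (And p (Neg (Eq (Var 0) (Var m))))} = S - {b}" for b
    using m unfolding S_def by auto
  then have "sat M e (atmost (Suc n) p) \<longleftrightarrow> (\<exists>b\<in>univ M. finite (S - {b}) \<and> card (S - {b}) \<le> n)"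
    unfolding atmost.simps Let_def m_def [symmetric] sat.simps(5) Suc.IH by simp
  also have "\<dots> \<longleftrightarrow> finite S \<and> card S \<le> Suc n"
  proof
    assume "\<exists>b\<in>univ M. finite (S - {b}) \<and> card (S - {b}) \<le> n"
    then show "finite S \<and> card S \<le> Suc n"
      by (metis Suc_le_mono card_Diff_singleton_if finite_Diff2 finite.emptyI finite_insert
          le_SucI Suc_pred card_gt_0_iff le_diff_conv Suc_eq_plus1)
  next
    assume S: "finite S \<and> card S \<le> Suc n"
    show "\<exists>b\<in>univ M. finite (S - {b}) \<and> card (S - {b}) \<le> n"
    proof (cases "S = {}")
      \<comment> \<open>There is nothing to delete, but the quantifier still needs some element;
        here the universe must be nonempty.\<close>
      case True
      then show ?thesis using assms by auto
    next
      case False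
      then obtain b where "b \<in> S" by blast
      then show ?thesis using S unfolding S_def by (intro bexI [of _ b]) auto
    qed
  qed
  finally show ?case unfolding S_def .
qed

lemma sat_case_nat_atmost:
  "univ M \<noteq> {} \<Longrightarrow> sat M (case_nat b e) (atmost n p) \<longleftrightarrow>
    finite (solutions M e p) \<and> card (solutions M e p) \<le> n"
  unfolding solutions_def sat_atmost by simp

lemma is_struc_nonempty: "is_struc L M \<Longrightarrow> univ M \<noteq> {}"
  unfolding is_struc_def by blast

lemma case_nat_comp: "(\<lambda>x. e (case_nat i s x)) = case_nat (e i) (\<lambda>v. e (s v))"
  by (auto split: nat.split)

lemma elem_equiv_case_nat:
  "elem_equiv L M e N f \<Longrightarrow> elem_equiv L M (case_nat (e i) (\<lambda>v. e (s v))) N (case_nat (f i) (\<lambda>v. f (s v)))"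
  using elem_equiv_comp [of L M e N f "case_nat i s"] unfolding case_nat_comp .

text \<open>Finiteness is not a formula, but it is the disjunction over n of the formulas
  \<open>atmost n p\<close>, and the two sides agree on each of them.\<close>

lemma elem_equiv_finite_solutions:
  assumes "elem_equiv L M e N f" "is_struc L M" "is_struc L N" "is_formula L p"
  shows "finite (solutions M e p) \<longleftrightarrow> finite (solutions N f p)"
proof -
  have "sat M (case_nat (e 0) e) (atmost n p) \<longleftrightarrow> sat N (case_nat (f 0) f) (atmost n p)" for n
    using elem_equiv_case_nat [OF assms(1), of 0 "\<lambda>v. v"] assms(4) by (simp add: elem_equivD)
  then show ?thesis
    using assms(2,3) is_struc_nonempty sat_case_nat_atmost by (metis order_refl)
qed

text \<open>Each parameter of a definition over the range equals some \<open>e v\<close>, so a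
  renaming lets the formula read all its parameters from e. This makes algebraicity over a countable
  set a property of the type of the tuple e, which elementary equivalence preserves.\<close>

lemma acl_range_iff:
  assumes e: "range e \<subseteq> univ M"
  shows "a \<in> acl L M (range e) \<longleftrightarrow>
    a \<in> univ M \<and> (\<exists>p. is_formula L p \<and> sat M (case_nat a e) p \<and> finite (solutions M e p))"
proof
  assume "a \<in> acl L M (range e)"
  then obtain p x f where p: "is_formula L p" "\<forall>y\<in>fv p - {x}. f y \<in> range e"
    and fin: "finite {c \<in> univ M. sat M (f(x := c)) p}" and a: "a \<in> univ M" "sat M (f(x := a)) p"
    unfolding acl_def definable_over_def by blast
  from p(2) have "\<forall>y\<in>fv p - {x}. \<exists>v. f y = e v" by blast
  then obtain s where s: "\<And>y. y \<in> fv p - {x} \<Longrightarrow> f y = e (s y)"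
    by (auto dest: bchoice)
  let ?q = "ren (\<lambda>v. if v = x then 0 else Suc (s v)) p"
  have "sat M (case_nat c e) ?q = sat M (f(x := c)) p" for c
    unfolding sat_ren using s by (intro sat_cong) auto
  then show "a \<in> univ M \<and> (\<exists>p. is_formula L p \<and> sat M (case_nat a e) p \<and> finite (solutions M e p))"
    using p(1) fin a unfolding solutions_def by (intro conjI exI [of _ ?q]) auto
next
  assume "a \<in> univ M \<and> (\<exists>p. is_formula L p \<and> sat M (case_nat a e) p \<and> finite (solutions M e p))"
  then obtain p where a: "a \<in> solutions M e p" and p: "is_formula L p" and fin: "finite (solutions M e p)"
    unfolding solutions_def by blast
  have "definable_over L M (range e) (solutions M e p)"
    unfolding definable_over_def solutions_def
    by (rule exI [of _ p], rule exI [of _ 0], rule exI [of _ "case_nat a e"])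
      (use p in \<open>auto split: nat.split\<close>)
  with a fin show "a \<in> acl L M (range e)" unfolding acl_def by blast
qed

lemma elem_equiv_acl:
  fixes s :: "nat \<Rightarrow> nat"
  assumes "elem_equiv L M e N f" "is_struc L M" "is_struc L N"
    and e: "range e \<subseteq> univ M" and f: "range f \<subseteq> univ N"
  shows "e i \<in> acl L M (range (\<lambda>v. e (s v))) \<longleftrightarrow> f i \<in> acl L N (range (\<lambda>v. f (s v)))"
proof -
  have r: "range (\<lambda>v. e (s v)) \<subseteq> univ M" "range (\<lambda>v. f (s v)) \<subseteq> univ N" using e f by auto
  have "sat M (case_nat (e i) (\<lambda>v. e (s v))) p \<and> finite (solutions M (\<lambda>v. e (s v)) p) \<longleftrightarrow>
      sat N (case_nat (f i) (\<lambda>v. f (s v))) p \<and> finite (solutions N (\<lambda>v. f (s v)) p)"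
    if "is_formula L p" for p
    using elem_equivD [OF elem_equiv_case_nat [OF assms(1), of i s] that]
      elem_equiv_finite_solutions [OF elem_equiv_comp [OF assms(1), of s] assms(2,3) that] by simp
  moreover have "e i \<in> univ M" "f i \<in> univ N" using e f by auto
  ultimately show ?thesis
    unfolding acl_range_iff [OF r(1)] acl_range_iff [OF r(2)] by auto
qed

lemma nonalgebraic_extension:
  fixes M :: "('f, 'r, 'v) struc"
  assumes large: "large_for TYPE('u) L" and M: "is_struc L M" and e: "range e \<subseteq> univ M"
    and p: "is_formula L p" and inf: "infinite (solutions M e p)"
  obtains N :: "('f, 'r, 'u) struc" and g where "is_struc L N" "range g \<subseteq> univ N"
    "elem_equiv L M e N (\<lambda>v. g (Suc v))" "sat N g p" "g 0 \<notin> acl L N (range (\<lambda>v. g (Suc v)))"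
proof -
  define D where "D = {q. is_formula L q \<and> sat M e q}"
  \<comment> \<open>Together these formulas say that slot 0 is nonalgebraic over the other slots: it
    satisfies no formula with at most n solutions, for any n.\<close>
  define E where "E = {Neg (And q (atmost n q)) | q n. is_formula L q}"
  define \<Sigma> where "\<Sigma> = insert p (ren Suc ` D \<union> E)"
  have "\<exists>(M :: ('f, 'r, 'v) struc) e. is_struc L M \<and> range e \<subseteq> univ M \<and> (\<forall>p\<in>F. sat M e p)"
    if F: "finite F" "F \<subseteq> \<Sigma>" for F
  proof -
    \<comment> \<open>The elements excluded by r. They are finitely many: r fails only at solutions
      of a formula with finitely many solutions. Finitely many such r cannot exhaust the infinite
      solution set of p.\<close>
    define B where "B = (\<lambda>r. {c \<in> univ M. \<not> sat M (case_nat c e) r})"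
    have "finite (B r)" if "r \<in> E" for r
    proof -
      from that obtain q n where r: "r = Neg (And q (atmost n q))" unfolding E_def by blast
      have "B r \<subseteq> (if finite (solutions M e q) then solutions M e q else {})"
        unfolding B_def r using sat_case_nat_atmost [OF is_struc_nonempty [OF M]]
        by (auto simp: solutions_def)
      then show ?thesis by (auto dest: finite_subset split: if_splits)
    qed
    then have "finite (\<Union>r\<in>F \<inter> E. B r)" using F(1) by blast
    with inf have "infinite (solutions M e p - (\<Union>r\<in>F \<inter> E. B r))" by (rule Diff_infinite_finite [rotated])
    then obtain c where c: "c \<in> solutions M e p" "c \<notin> (\<Union>r\<in>F \<inter> E. B r)"
      using infinite_imp_nonempty by blast
    have "sat M (case_nat c e) r" if "r \<in> F" for r
      using F(2) that c unfolding \<Sigma>_def B_def solutions_def D_def by auto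
    moreover have "range (case_nat c e) \<subseteq> univ M"
      using e c unfolding solutions_def by (auto simp: image_subset_iff split: nat.split)
    ultimately show ?thesis using M by blast
  qed
  moreover have "is_formula L q" if "q \<in> \<Sigma>" for q
    using that p unfolding \<Sigma>_def D_def E_def by auto
  ultimately obtain N :: "('f, 'r, 'u) struc" and g where N: "is_struc L N" "range g \<subseteq> univ N"
    and sat: "\<And>q. q \<in> \<Sigma> \<Longrightarrow> sat N g q"
    using compactness [OF large, of \<Sigma>, where ?'v = 'v] by metis
  have D: "sat N (\<lambda>v. g (Suc v)) q" if "is_formula L q" "sat M e q" for q
    using sat [of "ren Suc q"] that unfolding \<Sigma>_def D_def by auto
  have g: "case_nat (g 0) (\<lambda>v. g (Suc v)) = g" by (auto split: nat.split)
  show thesis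
  proof
    show "sat N g p" using sat unfolding \<Sigma>_def by blast
    show "elem_equiv L M e N (\<lambda>v. g (Suc v))"
      unfolding elem_equiv_def using D D [of "Neg _"] by auto
    have "range (\<lambda>v. g (Suc v)) \<subseteq> univ N" using N(2) by auto
    moreover have False if q: "is_formula L q" "sat N g q" and fin: "finite (solutions N (\<lambda>v. g (Suc v)) q)" for q
    proof -
      let ?n = "card (solutions N (\<lambda>v. g (Suc v)) q)"
      have "sat N (case_nat (g 0) (\<lambda>v. g (Suc v))) (atmost ?n q)"
        using fin sat_case_nat_atmost [OF is_struc_nonempty [OF N(1)]] by blast
      then have "sat N g (atmost ?n q)" unfolding g .
      moreover have "sat N g (Neg (And q (atmost ?n q)))"
        using sat q(1) unfolding \<Sigma>_def E_def by blast
      ultimately show False using q(2) by simp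
    qed
    ultimately show "g 0 \<notin> acl L N (range (\<lambda>v. g (Suc v)))"
      by (auto simp: acl_range_iff g)
  qed (fact N)+
qed

text \<open>Points are adjoined from the last formula of the list to the first. Each new point takes
  slot 0 and shifts the others up, so the point in slot i is nonalgebraic over all later slots,
  which comprise the earlier adjoined points and the parameters from slot \<open>length ps\<close>
  on.\<close>

theorem independent_extension:
  fixes M :: "('f, 'r, 'v) struc"
  assumes large: "large_for TYPE('u) L" and M: "is_struc L M" and e: "range e \<subseteq> univ M"
    and ps: "\<forall>p\<in>set ps. is_formula L p \<and> infinite (solutions M e p)"
  obtains N :: "('f, 'r, 'u) struc" and g where "is_struc L N" "range g \<subseteq> univ N"
    "elem_equiv L M e N (\<lambda>v. g (v + length ps))"
    "\<And>i. i < length ps \<Longrightarrow> g i \<in> solutions N (\<lambda>v. g (v + length ps)) (ps ! i)"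
    "\<And>i. i < length ps \<Longrightarrow> g i \<notin> acl L N (range (\<lambda>v. g (v + Suc i)))"
  using ps
proof (induction ps arbitrary: thesis)
  case Nil
  show ?case by (rule downward_loewenheim_skolem [OF large M e]) (rule Nil(1), auto)
next
  case (Cons p ps)
  let ?k = "length ps"
  obtain N :: "('f, 'r, 'u) struc" and g where N: "is_struc L N" "range g \<subseteq> univ N"
    and eq: "elem_equiv L M e N (\<lambda>v. g (v + ?k))"
    and sol: "\<And>i. i < ?k \<Longrightarrow> g i \<in> solutions N (\<lambda>v. g (v + ?k)) (ps ! i)"
    and na: "\<And>i. i < ?k \<Longrightarrow> g i \<notin> acl L N (range (\<lambda>v. g (v + Suc i)))"
    using Cons.IH Cons.prems(2) by (metis list.set_intros(2))
  \<comment> \<open>The parameters of p now sit behind the \<open>?k\<close> points adjoined so far,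
    so the renaming skips these.\<close>
  define p' where "p' = ren (case_nat 0 (\<lambda>v. Suc (v + ?k))) p"
  have p': "sat K h p' \<longleftrightarrow> sat K (case_nat (h 0) (\<lambda>v. h (Suc (v + ?k)))) p" for K :: "('f, 'r, 'u) struc" and h
    unfolding p'_def sat_ren case_nat_comp ..
  have p: "is_formula L p" "infinite (solutions M e p)" using Cons.prems by auto
  have "solutions N g p' = solutions N (\<lambda>v. g (v + ?k)) p"
    unfolding solutions_def p' by simp
  then have "infinite (solutions N g p')"
    using p elem_equiv_finite_solutions [OF eq M N(1) p(1)] by simp
  moreover have "is_formula L p'" using p unfolding p'_def by simp
  ultimately obtain N' :: "('f, 'r, 'u) struc" and g' where N': "is_struc L N'" "range g' \<subseteq> univ N'"
    and eq': "elem_equiv L N g N' (\<lambda>v. g' (Suc v))" and sat: "sat N' g' p'"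
    and na': "g' 0 \<notin> acl L N' (range (\<lambda>v. g' (Suc v)))"
    using nonalgebraic_extension [OF large N] by metis
  have S: "range (\<lambda>v. g' (Suc v)) \<subseteq> univ N'" using N'(2) by auto
  show ?case
  proof (rule Cons.prems(1))
    show "elem_equiv L M e N' (\<lambda>v. g' (v + length (p # ps)))"
      using elem_equiv_trans [OF eq elem_equiv_comp [OF eq']] by simp
    fix i assume i: "i < length (p # ps)"
    show "g' i \<in> solutions N' (\<lambda>v. g' (v + length (p # ps))) ((p # ps) ! i)"
    proof (cases i)
      case 0
      then show ?thesis using sat N'(2) unfolding p' solutions_def by auto
    next
      case (Suc j)
      then have "sat N (case_nat (g j) (\<lambda>v. g (v + ?k))) (ps ! j)" "is_formula L (ps ! j)"
        using sol [of j] i Cons.prems(2) unfolding solutions_def by auto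
      then show ?thesis
        using elem_equivD [OF elem_equiv_case_nat [OF eq']] N'(2) Suc unfolding solutions_def by auto
    qed
    show "g' i \<notin> acl L N' (range (\<lambda>v. g' (v + Suc i)))"
    proof (cases i)
      case 0
      then show ?thesis using na' by simp
    next
      case (Suc j)
      then show ?thesis
        using na [of j] i elem_equiv_acl [OF eq' N(1) N'(1) N(2) S, of j "\<lambda>v. v + Suc j"] by simp
    qed
  qed (fact N')+
qed


section \<open>Transitivity of algebraic closure and a rank count\<close>

lemma range_case_nat: "range (case_nat a e) = insert a (range e)"
proof (intro equalityI subsetI)
  fix y assume "y \<in> insert a (range e)"
  then consider "y = case_nat a e 0" | v where "y = case_nat a e (Suc v)" by auto
  then show "y \<in> range (case_nat a e)" by cases blast+
qed (auto split: nat.splits)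

lemma range_shift: "range (\<lambda>v. g (v + n)) = insert (g n) (range (\<lambda>v. g (v + Suc n)))"
proof -
  have "(\<lambda>v. g (v + n)) = case_nat (g n) (\<lambda>v. g (v + Suc n))" by (auto split: nat.split)
  then show ?thesis using range_case_nat by metis
qed

lemma sat_ren_case_nat:
  "sat M e (ren (case_nat i s) p) = sat M (case_nat (e i) (\<lambda>v. e (s v))) p"
  unfolding sat_ren case_nat_comp ..

lemma acl_mono: "A \<subseteq> B \<Longrightarrow> acl L M A \<subseteq> acl L M B"
  unfolding acl_def definable_over_def by blast

lemma acl_memI:
  assumes "a \<in> solutions M f p" "is_formula L p" "finite (solutions M f p)"
    "range f \<subseteq> univ M" "range f \<subseteq> A"
  shows "a \<in> acl L M A"
proof -
  have "a \<in> acl L M (range f)"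
    using assms(1-3) unfolding acl_range_iff [OF assms(4)] solutions_def by auto
  then show ?thesis using acl_mono [OF assms(5)] by blast
qed

lemma acl_range_trans:
  fixes e :: "nat \<Rightarrow> 'a"
  assumes M: "is_struc L M" and e: "range e \<subseteq> univ M"
    and z: "z \<in> acl L M (range e)" and b: "b \<in> acl L M (insert z (range e))"
  shows "b \<in> acl L M (range e)"
proof -
  obtain q where zu: "z \<in> univ M" and q: "is_formula L q" "sat M (case_nat z e) q" "finite (solutions M e q)"
    using z unfolding acl_range_iff [OF e] by blast
  have ze: "range (case_nat z e) \<subseteq> univ M" using e zu unfolding range_case_nat by simp
  obtain p where bu: "b \<in> univ M" and p: "is_formula L p" "sat M (case_nat b (case_nat z e)) p"
    "finite (solutions M (case_nat z e) p)"
    using b unfolding range_case_nat [symmetric] acl_range_iff [OF ze] by blast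
  define n where "n = card (solutions M (case_nat z e) p)"
  define r where "r = ren (case_nat 0 (case_nat 0 Suc))
    (Exi 1 (And (ren (case_nat 1 (\<lambda>v. v + 2)) q) (And p (atmost n p))))"
  have upd: "(case_nat c (case_nat c e))(1 := a) = case_nat c (case_nat a e)" for a c
    by (auto split: nat.split)
  have "(\<lambda>v. case_nat c e (case_nat 0 Suc v)) = case_nat c e" for c
    by (auto split: nat.split)
  then have "sat M (case_nat c e) r \<longleftrightarrow>
      (\<exists>a\<in>univ M. sat M (case_nat a e) q \<and> sat M (case_nat c (case_nat a e)) p \<and>
        sat M (case_nat c (case_nat a e)) (atmost n p))" for c
    unfolding r_def sat_ren_case_nat by (simp add: upd [simplified] sat_ren_case_nat del: sat_ren)
  then have r: "sat M (case_nat c e) r \<longleftrightarrow>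
      (\<exists>a\<in>solutions M e q. sat M (case_nat c (case_nat a e)) p \<and>
        finite (solutions M (case_nat a e) p) \<and> card (solutions M (case_nat a e) p) \<le> n)" for c
    unfolding sat_case_nat_atmost [OF is_struc_nonempty [OF M]] solutions_def [of M e q] by blast
  have "solutions M e r \<subseteq>
      (\<Union>a\<in>solutions M e q. if finite (solutions M (case_nat a e) p) then solutions M (case_nat a e) p else {})"
    unfolding solutions_def [of M e r] r by (auto simp: solutions_def [of M "case_nat _ _" p])
  moreover have "finite \<dots>" using q(3) by simp
  ultimately have "finite (solutions M e r)" by (rule finite_subset)
  moreover have "sat M (case_nat b e) r"
    unfolding r using p(2,3) q(2) zu by (intro bexI [of _ z]) (auto simp: n_def solutions_def)
  moreover have "is_formula L r" unfolding r_def using p(1) q(1) by simp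
  ultimately show ?thesis unfolding acl_range_iff [OF e] using bu by blast
qed

lemma acl_trans:
  fixes A :: "'a set"
  assumes "is_struc L M" "A \<subseteq> univ M" "countable A" "A \<noteq> {}"
    "z \<in> acl L M A" "b \<in> acl L M (insert z A)"
  shows "b \<in> acl L M A"
proof -
  obtain e :: "nat \<Rightarrow> 'a" where "A = range e"
    using assms(3,4) by (metis range_from_nat_into)
  then show ?thesis using assms acl_range_trans by metis
qed

text \<open>
  Two points that generate an element of \<open>acl B - acl A\<close> over \<open>A\<close> have rank at most one
  over \<open>B\<close>, so they do not generate two independent elements over \<open>B\<close>.
\<close>

lemma exchange_rank_argument:
  assumes M: "is_struc L M"
    and exch: "\<And>A a b. A \<subseteq> univ M \<Longrightarrow> a \<in> univ M \<Longrightarrow> b \<in> univ M \<Longrightarrow>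
      a \<in> acl L M (insert b A) \<Longrightarrow> a \<notin> acl L M A \<Longrightarrow> b \<in> acl L M (insert a A)"
    and A: "A \<subseteq> B" and B: "B \<subseteq> univ M" "countable B" "w \<in> B"
    and cd: "c \<in> univ M" "d \<in> univ M" and y: "y \<in> univ M" "y' \<in> univ M"
    and w: "w \<notin> acl L M A" "w \<in> acl L M (insert c (insert d A))"
    and indep: "y \<notin> acl L M B" "y' \<notin> acl L M (insert y B)"
    and gen: "y \<in> acl L M (insert c (insert d B))" "y' \<in> acl L M (insert c (insert d B))"
  shows False
proof -
  have wu: "w \<in> univ M" and Au: "A \<subseteq> univ M" using A B by auto
  \<comment> \<open>Exchange trades w for d, or for c when w is not algebraic over A and d. Since w
    lies in B, the traded coefficient becomes algebraic over B and the other one, and that other one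
    is t.\<close>
  have "\<exists>t\<in>univ M. y \<in> acl L M (insert t B) \<and> y' \<in> acl L M (insert t B)"
  proof (cases "w \<in> acl L M (insert d A)")
    case True
    then have "d \<in> acl L M (insert w A)" using exch [OF Au wu cd(2)] w(1) by blast
    moreover have "insert w A \<subseteq> insert c B" using A B by blast
    ultimately have "d \<in> acl L M (insert c B)" using acl_mono by blast
    then have "v \<in> acl L M (insert c B)" if "v \<in> acl L M (insert d (insert c B))" for v
      using that B cd by (intro acl_trans [OF M, of "insert c B" d v]) auto
    then show ?thesis using gen cd by (auto simp: insert_commute)
  next
    case False
    then have "c \<in> acl L M (insert w (insert d A))"
      using exch [of "insert d A" w c] Au wu cd w(2) by blast
    moreover have "insert w (insert d A) \<subseteq> insert d B" using A B by blast
    ultimately have "c \<in> acl L M (insert d B)" using acl_mono by blast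
    then have "v \<in> acl L M (insert d B)" if "v \<in> acl L M (insert c (insert d B))" for v
      using that B cd by (intro acl_trans [OF M, of "insert d B" c v]) auto
    then show ?thesis using gen cd by auto
  qed
  then obtain t where t: "t \<in> univ M" "y \<in> acl L M (insert t B)" "y' \<in> acl L M (insert t B)" by blast
  \<comment> \<open>The nonalgebraic y already uses up the single dimension of t over B, leaving
    none for y'.\<close>
  have "t \<in> acl L M (insert y B)" using exch [OF B(1) y(1) t(1)] t(2) indep(1) by blast
  moreover have "y' \<in> acl L M (insert t (insert y B))"
    using t(3) acl_mono [of "insert t B" "insert t (insert y B)"] by blast
  ultimately have "y' \<in> acl L M (insert y B)"
    using B y by (intro acl_trans [OF M, of "insert y B" t y']) auto
  with indep(2) show False by blast
qed

section \<open>Fields\<close>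

text \<open>The ring record has no field for negation, so \<open>RNeg\<close> is not represented;
  the formulas below use addition and multiplication only.\<close>

definition ring_of :: "(ring_sym + 'f, 'r, 'u) struc \<Rightarrow> 'u ring" where
  "ring_of M = \<lparr>carrier = univ M, monoid.mult = (\<lambda>a b. fint M (Inl RTimes) [a, b]),
     one = fint M (Inl ROne) [], zero = fint M (Inl RZero) [],
     add = (\<lambda>a b. fint M (Inl RPlus) [a, b])\<rparr>"

lemma carrier_ring_of [simp]: "carrier (ring_of M) = univ M"
  by (simp add: ring_of_def)

lemma tval_ring [simp]:
  "tval M e (App (Inl RPlus) [s, t]) = tval M e s \<oplus>\<^bsub>ring_of M\<^esub> tval M e t"
  "tval M e (App (Inl RTimes) [s, t]) = tval M e s \<otimes>\<^bsub>ring_of M\<^esub> tval M e t"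
  "tval M e (App (Inl RZero) []) = \<zero>\<^bsub>ring_of M\<^esub>"
  "tval M e (App (Inl ROne) []) = \<one>\<^bsub>ring_of M\<^esub>"
  by (simp_all add: ring_of_def)

lemma sublang_L_ring:
  assumes "sublang L_ring (L :: (ring_sym + 'f, 'r) lang)"
  shows "Inl s \<in> Funs L" "farity L (Inl s) = ring_arity s"
  using assms unfolding sublang_def L_ring_def by auto

lemma field_ring_of:
  fixes M :: "(ring_sym + 'f, 'r, 'u) struc"
  assumes M: "is_struc L M" and sub: "sublang L_ring L"
    and ax: "\<And>p. p \<in> field_axioms \<Longrightarrow> holds M p"
  shows "field (ring_of M)"
proof -
  let ?R = "ring_of M"
  let ?neg = "\<lambda>a. fint M (Inl RNeg) [a]"
  obtain c where c: "c \<in> univ M" using is_struc_nonempty [OF M] by blast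
  have clo: "fint M (Inl s) as \<in> univ M" if "set as \<subseteq> univ M" "length as = ring_arity s" for s as
    using M that sublang_L_ring [OF sub] unfolding is_struc_def by auto
  have sat: "sat M (\<lambda>_. c) p" if "p \<in> field_axioms" for p
    using ax [OF that] c unfolding holds_def by auto
  note ax' = sat [unfolded field_axioms_def Let_def]
  have closed: "a \<oplus>\<^bsub>?R\<^esub> b \<in> univ M" "a \<otimes>\<^bsub>?R\<^esub> b \<in> univ M" "\<zero>\<^bsub>?R\<^esub> \<in> univ M" "\<one>\<^bsub>?R\<^esub> \<in> univ M" "?neg a \<in> univ M"
    if "a \<in> univ M" "b \<in> univ M" for a b
    using that clo [of "[a, b]" RPlus] clo [of "[a, b]" RTimes] clo [of "[]" RZero] clo [of "[]" ROne]
      clo [of "[a]" RNeg] by (auto simp: ring_of_def)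
  have add_assoc: "\<forall>a\<in>univ M. \<forall>b\<in>univ M. \<forall>d\<in>univ M. (a \<oplus>\<^bsub>?R\<^esub> b) \<oplus>\<^bsub>?R\<^esub> d = a \<oplus>\<^bsub>?R\<^esub> (b \<oplus>\<^bsub>?R\<^esub> d)"
    using ax' [of "Uni 0 (Uni 1 (Uni 2 (Eq (tplus (tplus (Var 0) (Var 1)) (Var 2)) (tplus (Var 0) (tplus (Var 1) (Var 2))))))"] by (simp add: ring_of_def)
  have add_comm: "\<forall>a\<in>univ M. \<forall>b\<in>univ M. a \<oplus>\<^bsub>?R\<^esub> b = b \<oplus>\<^bsub>?R\<^esub> a"
    using ax' [of "Uni 0 (Uni 1 (Eq (tplus (Var 0) (Var 1)) (tplus (Var 1) (Var 0))))"] by (simp add: ring_of_def)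
  have add_zero: "\<forall>a\<in>univ M. a \<oplus>\<^bsub>?R\<^esub> \<zero>\<^bsub>?R\<^esub> = a"
    using ax' [of "Uni 0 (Eq (tplus (Var 0) tzero) (Var 0))"] by (simp add: ring_of_def)
  have add_neg: "\<forall>a\<in>univ M. a \<oplus>\<^bsub>?R\<^esub> ?neg a = \<zero>\<^bsub>?R\<^esub>"
    using ax' [of "Uni 0 (Eq (tplus (Var 0) (tneg (Var 0))) tzero)"] by (simp add: ring_of_def)
  have mult_assoc: "\<forall>a\<in>univ M. \<forall>b\<in>univ M. \<forall>d\<in>univ M. (a \<otimes>\<^bsub>?R\<^esub> b) \<otimes>\<^bsub>?R\<^esub> d = a \<otimes>\<^bsub>?R\<^esub> (b \<otimes>\<^bsub>?R\<^esub> d)"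
    using ax' [of "Uni 0 (Uni 1 (Uni 2 (Eq (ttimes (ttimes (Var 0) (Var 1)) (Var 2)) (ttimes (Var 0) (ttimes (Var 1) (Var 2))))))"] by (simp add: ring_of_def)
  have mult_comm: "\<forall>a\<in>univ M. \<forall>b\<in>univ M. a \<otimes>\<^bsub>?R\<^esub> b = b \<otimes>\<^bsub>?R\<^esub> a"
    using ax' [of "Uni 0 (Uni 1 (Eq (ttimes (Var 0) (Var 1)) (ttimes (Var 1) (Var 0))))"] by (simp add: ring_of_def)
  have mult_one: "\<forall>a\<in>univ M. a \<otimes>\<^bsub>?R\<^esub> \<one>\<^bsub>?R\<^esub> = a"
    using ax' [of "Uni 0 (Eq (ttimes (Var 0) tone) (Var 0))"] by (simp add: ring_of_def)
  have distr: "\<forall>a\<in>univ M. \<forall>b\<in>univ M. \<forall>d\<in>univ M. a \<otimes>\<^bsub>?R\<^esub> (b \<oplus>\<^bsub>?R\<^esub> d) = a \<otimes>\<^bsub>?R\<^esub> b \<oplus>\<^bsub>?R\<^esub> a \<otimes>\<^bsub>?R\<^esub> d"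
    using ax' [of "Uni 0 (Uni 1 (Uni 2 (Eq (ttimes (Var 0) (tplus (Var 1) (Var 2))) (tplus (ttimes (Var 0) (Var 1)) (ttimes (Var 0) (Var 2))))))"] by (simp add: ring_of_def)
  have zero_one: "\<zero>\<^bsub>?R\<^esub> \<noteq> \<one>\<^bsub>?R\<^esub>"
    using ax' [of "Neg (Eq tzero tone)"] by (simp add: ring_of_def)
  have inv: "\<forall>a\<in>univ M. a \<noteq> \<zero>\<^bsub>?R\<^esub> \<longrightarrow> (\<exists>b\<in>univ M. a \<otimes>\<^bsub>?R\<^esub> b = \<one>\<^bsub>?R\<^esub>)"
    using ax' [of "Uni 0 (Imp (Neg (Eq (Var 0) tzero)) (Exi 1 (Eq (ttimes (Var 0) (Var 1)) tone)))"] by (auto simp: ring_of_def)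
  have "abelian_group ?R"
  proof (rule abelian_groupI)
    show "\<exists>b\<in>carrier ?R. b \<oplus>\<^bsub>?R\<^esub> a = \<zero>\<^bsub>?R\<^esub>" if "a \<in> carrier ?R" for a
      using that closed add_neg add_comm by (intro bexI [of _ "?neg a"]) auto
    show "\<zero>\<^bsub>?R\<^esub> \<oplus>\<^bsub>?R\<^esub> a = a" if "a \<in> carrier ?R" for a
      using that closed(3) [OF c c] add_zero add_comm by simp
    show "a \<oplus>\<^bsub>?R\<^esub> b = b \<oplus>\<^bsub>?R\<^esub> a" if "a \<in> carrier ?R" "b \<in> carrier ?R" for a b
      using that add_comm by simp
  qed (use closed(1) closed(3) [OF c c] add_assoc in simp_all)
  moreover have "Group.comm_monoid ?R"
  proof (rule comm_monoidI)
    show "\<one>\<^bsub>?R\<^esub> \<otimes>\<^bsub>?R\<^esub> a = a" if "a \<in> carrier ?R" for a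
      using that closed(4) [OF c c] mult_one mult_comm by simp
    show "a \<otimes>\<^bsub>?R\<^esub> b = b \<otimes>\<^bsub>?R\<^esub> a" if "a \<in> carrier ?R" "b \<in> carrier ?R" for a b
      using that mult_comm by simp
  qed (use closed(2) closed(4) [OF c c] mult_assoc in simp_all)
  ultimately interpret R: cring ?R
  proof (rule cringI)
    fix a b d assume "a \<in> carrier ?R" "b \<in> carrier ?R" "d \<in> carrier ?R"
    then show "(a \<oplus>\<^bsub>?R\<^esub> b) \<otimes>\<^bsub>?R\<^esub> d = a \<otimes>\<^bsub>?R\<^esub> d \<oplus>\<^bsub>?R\<^esub> b \<otimes>\<^bsub>?R\<^esub> d"
      using distr mult_comm closed by simp
  qed
  show ?thesis
    by (rule R.cring_fieldI2) (use zero_one inv in auto)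
qed

text \<open>
  The subtraction-free form of \<open>(S - S) / (S - S) = K\<close>.
\<close>

definition spread :: "('a, 'b) ring_scheme \<Rightarrow> 'a set \<Rightarrow> bool" where
  "spread R S \<longleftrightarrow> (\<forall>u\<in>carrier R. \<exists>a\<in>S. \<exists>b\<in>S. \<exists>c\<in>S. \<exists>d\<in>S.
     c \<noteq> d \<and> a \<oplus>\<^bsub>R\<^esub> u \<otimes>\<^bsub>R\<^esub> c = b \<oplus>\<^bsub>R\<^esub> u \<otimes>\<^bsub>R\<^esub> d)"

text \<open>A quadruple with c different from d determines u as (b - a) / (c - d), so a finite S
  accounts for at most |S|^4 values of u.\<close>

lemma (in field) spread_imp_infinite:
  assumes "spread R S" "S \<subseteq> carrier R" "infinite (carrier R)"
  shows "infinite S"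
proof
  assume fin: "finite S"
  have "\<forall>u\<in>carrier R. \<exists>t. t \<in> S \<times> S \<times> S \<times> S \<and>
      (case t of (a, b, c, d) \<Rightarrow> c \<noteq> d \<and> a \<oplus> u \<otimes> c = b \<oplus> u \<otimes> d)"
    using assms(1) unfolding spread_def by fast
  from bchoice [OF this] obtain f where f: "\<forall>u\<in>carrier R. f u \<in> S \<times> S \<times> S \<times> S \<and>
      (case f u of (a, b, c, d) \<Rightarrow> c \<noteq> d \<and> a \<oplus> u \<otimes> c = b \<oplus> u \<otimes> d)" ..
  have "inj_on f (carrier R)"
  proof (rule inj_onI)
    fix u v assume u: "u \<in> carrier R" and v: "v \<in> carrier R" and eq: "f u = f v"
    obtain a b c d where t: "f u = (a, b, c, d)" by (metis prod_cases4)
    have S: "a \<in> carrier R" "b \<in> carrier R" "c \<in> carrier R" "d \<in> carrier R"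
      using f u t assms(2) by force+
    have cd: "c \<noteq> d" and eqs: "a \<oplus> u \<otimes> c = b \<oplus> u \<otimes> d" "a \<oplus> v \<otimes> c = b \<oplus> v \<otimes> d"
      using bspec [OF f u] bspec [OF f v] t eq by simp_all
    have slope: "x \<otimes> (c \<ominus> d) = b \<ominus> a"
      if "x \<in> carrier R" "a \<oplus> x \<otimes> c = b \<oplus> x \<otimes> d" for x
    proof -
      have "x \<otimes> (c \<ominus> d) = (a \<oplus> x \<otimes> c) \<ominus> (a \<oplus> x \<otimes> d)" using S that(1) by algebra
      also have "\<dots> = (b \<oplus> x \<otimes> d) \<ominus> (a \<oplus> x \<otimes> d)" using that(2) by simp
      also have "\<dots> = b \<ominus> a" using S that(1) by algebra
      finally show ?thesis .
    qed
    have "u \<otimes> (c \<ominus> d) = v \<otimes> (c \<ominus> d)" using slope u v eqs by simp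
    moreover have "c \<ominus> d \<noteq> \<zero>" using cd S by simp
    ultimately show "u = v" using u v S m_rcancel by simp
  qed
  moreover have "finite (f ` carrier R)"
    using f fin by (intro finite_subset [of "f ` carrier R" "S \<times> S \<times> S \<times> S"]) auto
  ultimately show False using assms(3) finite_imageD by blast
qed

lemma (in field) line_through:
  assumes "x \<in> carrier R" "x' \<in> carrier R" "y \<in> carrier R" "y' \<in> carrier R" "x \<noteq> x'" "y \<noteq> y'"
  obtains c d where "c \<in> carrier R" "d \<in> carrier R" "c \<noteq> \<zero>" "y = c \<otimes> x \<oplus> d" "y' = c \<otimes> x' \<oplus> d"
proof
  let ?i = "inv (x \<ominus> x')"
  let ?c = "(y \<ominus> y') \<otimes> ?i"
  let ?d = "y \<ominus> ?c \<otimes> x"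
  have u: "x \<ominus> x' \<in> Units R" and n: "y \<ominus> y' \<noteq> \<zero>"
    using assms field_Units by auto
  have i: "?i \<in> carrier R" using u by simp
  have one: "(x \<ominus> x') \<otimes> ?i = \<one>" using u by simp
  show c: "?c \<in> carrier R" using assms i by simp
  then show d: "?d \<in> carrier R" using assms by simp
  show "?c \<noteq> \<zero>"
  proof
    assume *: "?c = \<zero>"
    have "y \<ominus> y' = (y \<ominus> y') \<otimes> ((x \<ominus> x') \<otimes> ?i)" using assms one by simp
    also have "\<dots> = ?c \<otimes> (x \<ominus> x')" using assms i by algebra
    finally show False using * n assms by simp
  qed
  show "y = ?c \<otimes> x \<oplus> ?d" using assms c by algebra
  have "?c \<otimes> x' \<oplus> ?d = y \<ominus> (y \<ominus> y') \<otimes> ((x \<ominus> x') \<otimes> ?i)" using assms i by algebra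
  also have "\<dots> = y'" unfolding one using assms by algebra
  finally show "y' = ?c \<otimes> x' \<oplus> ?d" by simp
qed


section \<open>Splitting by affine images\<close>

lemma solutions_ren_Suc:
  "solutions M e (ren (case_nat 0 (\<lambda>v. Suc (s v))) p) = solutions M (\<lambda>v. e (s v)) p"
  unfolding solutions_def sat_ren_case_nat by simp

lemma solutions_And: "solutions M e (And p q) = solutions M e p \<inter> solutions M e q"
  unfolding solutions_def by auto

lemma solutions_Neg: "solutions M e (Neg p) = univ M - solutions M e p"
  unfolding solutions_def by auto

lemma bex_solutions: "(\<exists>a\<in>univ M. sat M (case_nat a e) p \<and> Q a) \<longleftrightarrow> (\<exists>a\<in>solutions M e p. Q a)"
  unfolding solutions_def by blast

text \<open>
  Slots \<open>0\<close> to \<open>3\<close> are the bound points, slot \<open>4\<close> is the multiplier, and the parameters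
  of \<open>p\<close> start at slot \<open>5\<close>.
\<close>

definition collision_fm :: "(ring_sym + 'f, 'r) fm \<Rightarrow> (ring_sym + 'f, 'r) fm" where
  "collision_fm p =
    Exi 0 (And (ren (case_nat 0 (\<lambda>v. v + 5)) p)
   (Exi 1 (And (ren (case_nat 1 (\<lambda>v. v + 5)) p)
   (Exi 2 (And (ren (case_nat 2 (\<lambda>v. v + 5)) p)
   (Exi 3 (And (ren (case_nat 3 (\<lambda>v. v + 5)) p)
     (And (Neg (Eq (Var 2) (Var 3)))
       (Eq (tplus (Var 0) (ttimes (Var 4) (Var 2))) (tplus (Var 1) (ttimes (Var 4) (Var 3))))))))))))"

abbreviation spread_fm :: "(ring_sym + 'f, 'r) fm \<Rightarrow> (ring_sym + 'f, 'r) fm" where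
  "spread_fm p \<equiv> Uni 4 (collision_fm p)"

lemma is_formula_collision_fm:
  "sublang L_ring L \<Longrightarrow> is_formula L (collision_fm p) = is_formula L p"
  by (simp add: collision_fm_def sublang_L_ring)

lemma sat_collision_fm:
  "sat M h (collision_fm p) \<longleftrightarrow> (let S = solutions M (\<lambda>v. h (v + 5)) p in
     \<exists>a\<in>S. \<exists>b\<in>S. \<exists>c\<in>S. \<exists>d\<in>S. c \<noteq> d \<and>
       a \<oplus>\<^bsub>ring_of M\<^esub> h 4 \<otimes>\<^bsub>ring_of M\<^esub> c = b \<oplus>\<^bsub>ring_of M\<^esub> h 4 \<otimes>\<^bsub>ring_of M\<^esub> d)"
  unfolding collision_fm_def Let_def bex_solutions [symmetric]
  by (simp add: sat_ren_case_nat ring_of_def del: sat_ren)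

lemma sat_spread_fm:
  "sat M h (spread_fm p) \<longleftrightarrow> spread (ring_of M) (solutions M (\<lambda>v. h (v + 5)) p)"
  by (simp add: sat_collision_fm spread_def Let_def)

text \<open>
  Slot \<open>0\<close> lies in the image of the set defined by \<open>p\<close> under the affine map with slope in
  slot \<open>1\<close> and intercept in slot \<open>2\<close>; slot \<open>3\<close> is used for the bound variable.
\<close>

definition affine_fm :: "(ring_sym + 'f, 'r) fm \<Rightarrow> (ring_sym + 'f, 'r) fm" where
  "affine_fm p = Exi 3 (And (ren (case_nat 3 (\<lambda>v. v + 4)) p)
     (Eq (Var 0) (tplus (ttimes (Var 1) (Var 3)) (Var 2))))"

text \<open>With a point z placed in front, c, d and the parameters occupy slots 1, 2 and 4 onwards,
  as \<open>affine_fm\<close> expects. Slot 3 is bound there; its filler \<open>e 0\<close> adds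
  nothing to the range, so algebraicity over this assignment is algebraicity over c, d and the range
  of e.\<close>

definition affine_params :: "'u \<Rightarrow> 'u \<Rightarrow> (nat \<Rightarrow> 'u) \<Rightarrow> nat \<Rightarrow> 'u" where
  "affine_params c d e = case_nat c (case_nat d (case_nat (e 0) e))"

definition affine_image :: "('a, 'b) ring_scheme \<Rightarrow> 'a set \<Rightarrow> 'a \<times> 'a \<Rightarrow> 'a set" where
  "affine_image R S = (\<lambda>(c, d). (\<lambda>w. c \<otimes>\<^bsub>R\<^esub> w \<oplus>\<^bsub>R\<^esub> d) ` S)"

lemma affine_params_simps [simp]:
  "affine_params c d e 0 = c" "affine_params c d e (Suc 0) = d" "affine_params c d e 2 = e 0"
  "affine_params c d e (v + 3) = e v"
  by (simp_all add: affine_params_def numeral_eq_Suc)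

lemma range_affine_params: "range (affine_params c d e) = insert c (insert d (range e))"
  unfolding affine_params_def range_case_nat by auto

lemma is_formula_affine_fm:
  "sublang L_ring L \<Longrightarrow> is_formula L (affine_fm p) = is_formula L p"
  by (simp add: affine_fm_def sublang_L_ring)

lemma sat_affine_fm:
  "sat M (case_nat z (affine_params c d e)) (affine_fm p) \<longleftrightarrow>
     z \<in> affine_image (ring_of M) (solutions M e p) (c, d)"
proof -
  have "case_nat z (affine_params c d e) 2 = d" "\<And>v. case_nat z (affine_params c d e) (v + 4) = e v"
    by (simp_all add: affine_params_def numeral_eq_Suc)
  then show ?thesis
    unfolding affine_fm_def affine_image_def image_iff split_def bex_solutions [symmetric]
    by (simp add: sat_ren_case_nat ring_of_def del: sat_ren)
qed

definition affine_inter_fm ::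
    "(ring_sym + 'f, 'r) fm \<Rightarrow> (ring_sym + 'f, 'r) fm \<Rightarrow> (ring_sym + 'f, 'r) fm" where
  "affine_inter_fm q p = And (ren (case_nat 0 (\<lambda>v. v + 4)) q) (affine_fm p)"

definition affine_diff_fm ::
    "(ring_sym + 'f, 'r) fm \<Rightarrow> (ring_sym + 'f, 'r) fm \<Rightarrow> (ring_sym + 'f, 'r) fm" where
  "affine_diff_fm q p = And (ren (case_nat 0 (\<lambda>v. v + 4)) q) (Neg (affine_fm p))"

lemma is_formula_affine_inter_diff:
  assumes "sublang L_ring L"
  shows "is_formula L (affine_inter_fm q p) \<longleftrightarrow> is_formula L q \<and> is_formula L p"
    "is_formula L (affine_diff_fm q p) \<longleftrightarrow> is_formula L q \<and> is_formula L p"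
  using is_formula_affine_fm [OF assms] by (auto simp: affine_inter_fm_def affine_diff_fm_def)

lemma solutions_affine:
  shows "solutions M (affine_params c d e) (affine_inter_fm q p) =
      solutions M e q \<inter> affine_image (ring_of M) (solutions M e p) (c, d)"
    and "solutions M (affine_params c d e) (affine_diff_fm q p) =
      solutions M e q - affine_image (ring_of M) (solutions M e p) (c, d)"
proof -
  have "solutions M (affine_params c d e) (ren (case_nat 0 (\<lambda>v. v + 4)) q) = solutions M e q"
    using solutions_ren_Suc [of M "affine_params c d e" "\<lambda>v. v + 3" q] by (simp del: affine_params_simps add: affine_params_def numeral_eq_Suc)
  moreover have "solutions M f (affine_fm p) = {z \<in> univ M. sat M (case_nat z f) (affine_fm p)}" for f
    unfolding solutions_def ..
  moreover have "solutions M e q \<subseteq> univ M" unfolding solutions_def by blast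
  ultimately show "solutions M (affine_params c d e) (affine_inter_fm q p) =
      solutions M e q \<inter> affine_image (ring_of M) (solutions M e p) (c, d)"
    "solutions M (affine_params c d e) (affine_diff_fm q p) =
      solutions M e q - affine_image (ring_of M) (solutions M e p) (c, d)"
    by (auto simp: affine_inter_fm_def affine_diff_fm_def solutions_And solutions_Neg sat_affine_fm)
qed

text \<open>\<open>spread_fm\<close> reads the parameters of its argument from slot 5 on, so c and d
  are in slots 5 and 6, the filler of \<open>affine_params\<close> in slot 7 and the parameters of q
  and p from slot 8. The filler repeats the first parameter, whence the hypothesis
  \<open>h 7 = h 8\<close> of the next lemma.\<close>

definition split_fm ::
    "(ring_sym + 'f, 'r) fm \<Rightarrow> (ring_sym + 'f, 'r) fm \<Rightarrow> (ring_sym + 'f, 'r) fm" where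
  "split_fm q p = Exi 5 (Exi 6 (And (spread_fm (affine_inter_fm q p)) (spread_fm (affine_diff_fm q p))))"

lemma sat_split_fm:
  assumes "h 7 = h 8"
  shows "sat M h (split_fm q p) \<longleftrightarrow> (\<exists>c\<in>univ M. \<exists>d\<in>univ M.
    spread (ring_of M) (solutions M (affine_params c d (\<lambda>v. h (v + 8))) (affine_inter_fm q p)) \<and>
    spread (ring_of M) (solutions M (affine_params c d (\<lambda>v. h (v + 8))) (affine_diff_fm q p)))"
proof -
  have "(\<lambda>v. (h(5 := c, 6 := d)) (v + 5)) = affine_params c d (\<lambda>v. h (v + 8))" for c d
  proof
    fix v :: nat
    consider "v = 0" | "v = Suc 0" | "v = 2" | w where "v = w + 3"
      by (metis One_nat_def add.commute le_Suc_ex less_2_cases_iff less_Suc_eq not_le numeral_3_eq_3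
          numeral_2_eq_2)
    then show "(h(5 := c, 6 := d)) (v + 5) = affine_params c d (\<lambda>v. h (v + 8)) v"
      using assms by cases (simp_all add: add.assoc)
  qed
  then show ?thesis
    unfolding split_fm_def sat.simps(4,5) sat_spread_fm by simp
qed

section \<open>Models of a pregeometric theory of fields\<close>

locale pregeometric_field_theory =
  fixes L :: "(ring_sym + 'f, 'r) lang" and T :: "(ring_sym + 'f, 'r) fm set" and U :: "'u itself"
  assumes large: "large_for TYPE('u) L"
    and ring: "sublang L_ring L"
    and complete: "complete_theory TYPE('u) L T"
    and infinite_model: "has_infinite_model TYPE('u) L T"
    and field: "\<forall>p\<in>field_axioms. entails TYPE('u) L T p"
    and pregeometric: "pregeometric TYPE('u) L T"
begin

lemma T_theory: "is_theory L T"
  using complete unfolding complete_theory_def by blast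

text \<open>Bridge from a model in any type to one in \<open>'u\<close>, where the hypotheses live.
  It serves to carry over sentences, so a constant assignment is enough.\<close>

lemma model_equiv:
  fixes M :: "(ring_sym + 'f, 'r, 'v) struc"
  assumes M: "is_model L T M"
  obtains N :: "(ring_sym + 'f, 'r, 'u) struc" and e f where "is_model L T N" "range e \<subseteq> univ M"
    "range f \<subseteq> univ N" "elem_equiv L M e N f"
proof -
  have s: "is_struc L M" using M unfolding is_model_def by blast
  obtain a where a: "a \<in> univ M" using is_struc_nonempty [OF s] by blast
  then have e: "range (\<lambda>_::nat. a) \<subseteq> univ M" by auto
  obtain N :: "(ring_sym + 'f, 'r, 'u) struc" and f where
    N: "is_struc L N" "range f \<subseteq> univ N" "elem_equiv L M (\<lambda>_. a) N f"
    using downward_loewenheim_skolem [OF large s e] by metis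
  with elem_equiv_model [OF N(3) T_theory M N(1) e N(2)] e show thesis using that by blast
qed

lemma model_field:
  fixes M :: "(ring_sym + 'f, 'r, 'v) struc"
  assumes M: "is_model L T M"
  shows "field (ring_of M)"
proof (rule field_ring_of)
  show "is_struc L M" using M unfolding is_model_def by blast
  obtain N :: "(ring_sym + 'f, 'r, 'u) struc" and e f where N: "is_model L T N"
    "range e \<subseteq> univ M" "range f \<subseteq> univ N" "elem_equiv L M e N f"
    using model_equiv [OF M] by metis
  fix p :: "(ring_sym + 'f, 'r) fm" assume p: "p \<in> field_axioms"
  have s: "is_sentence L p"
    using p sublang_L_ring [OF ring]
    unfolding field_axioms_def is_sentence_def Let_def by (auto simp: insert_commute)
  have "sat N f p" using field p N(1,3) unfolding entails_def holds_def by blast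
  then have "sat M e p" using elem_equivD [OF N(4)] s unfolding is_sentence_def by blast
  then show "holds M p" using holds_iff_sat [OF s N(2)] by blast
qed (fact ring)

text \<open>A model with n elements would make "at most n elements" consistent with T, hence by
  completeness a consequence of T, against the given infinite model.\<close>

lemma model_infinite:
  fixes M :: "(ring_sym + 'f, 'r, 'v) struc"
  assumes M: "is_model L T M"
  shows "infinite (univ M)"
proof
  assume fin: "finite (univ M)"
  obtain N :: "(ring_sym + 'f, 'r, 'u) struc" and e f where N: "is_model L T N"
    "range e \<subseteq> univ M" "range f \<subseteq> univ N" "elem_equiv L M e N f"
    using model_equiv [OF M] by metis
  obtain K :: "(ring_sym + 'f, 'r, 'u) struc" where K: "is_model L T K" "infinite (univ K)"
    using infinite_model unfolding has_infinite_model_def by blast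
  let ?t = "Eq (Var 0) (Var 0) :: (ring_sym + 'f, 'r) fm" and ?n = "card (univ M)"
  have sat: "sat A k (atmost ?n ?t) \<longleftrightarrow> finite (univ A) \<and> card (univ A) \<le> ?n"
    if "is_struc L A" for A :: "(ring_sym + 'f, 'r, 'x) struc" and k
    using sat_atmost [OF is_struc_nonempty [OF that], of k ?n ?t] by simp
  have st: "is_struc L M" "is_struc L N" "is_struc L K" using M N K unfolding is_model_def by auto
  obtain k :: "nat \<Rightarrow> 'u" where k: "range k \<subseteq> univ K"
    using is_struc_nonempty [OF st(3)] that [of "\<lambda>_. SOME a. a \<in> univ K"]
    by (auto simp: some_in_eq)
  let ?p = "Uni 0 (atmost ?n ?t)"
  have fv: "fv (atmost n p) \<subseteq> fv p - {0}" for n and p :: "(ring_sym + 'f, 'r) fm"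
    by (induction n arbitrary: p) (force simp: Let_def)+
  have p: "is_sentence L ?p" unfolding is_sentence_def using fv [of ?n ?t] by auto
  have pA: "sat A k ?p \<longleftrightarrow> finite (univ A) \<and> card (univ A) \<le> ?n"
    if "is_struc L A" for A :: "(ring_sym + 'f, 'r, 'u) struc" and k
    using sat [OF that] is_struc_nonempty [OF that] by auto
  have "sat M e (atmost ?n ?t)"
    using sat_atmost [OF is_struc_nonempty [OF st(1)], of e ?n ?t] fin by simp
  then have "sat N f (atmost ?n ?t)" using elem_equivD [OF N(4)] by simp
  then have "sat N f ?p" using pA [OF st(2)] sat [OF st(2)] by blast
  then have "\<not> holds N (Neg ?p)" using N(3) unfolding holds_def by auto
  then have "\<not> entails TYPE('u) L T (Neg ?p)" using N(1) unfolding entails_def by blast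
  then have "entails TYPE('u) L T ?p" using complete p unfolding complete_theory_def by blast
  then have "sat K k ?p" using K(1) k unfolding entails_def holds_def by blast
  then show False using pA [OF st(3)] K(2) by blast
qed

lemma exchange:
  fixes N :: "(ring_sym + 'f, 'r, 'u) struc"
  assumes "is_model L T N" "A \<subseteq> univ N" "a \<in> univ N" "b \<in> univ N"
    "a \<in> acl L N (insert b A)" "a \<notin> acl L N A"
  shows "b \<in> acl L N (insert a A)"
  using pregeometric assms unfolding pregeometric_def by blast

text \<open>
  If \<open>u\<close> is not a quotient of differences of \<open>S\<close>, then \<open>(x, y) \<mapsto> x + u y\<close> is injective on
  \<open>S \<times> S\<close>, so a rank one element generates two independent points of \<open>S\<close>.
\<close>

lemma infinite_imp_spread:
  fixes M :: "(ring_sym + 'f, 'r, 'v) struc"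
  assumes M: "is_model L T M" and e: "range e \<subseteq> univ M"
    and p: "is_formula L p" and inf: "infinite (solutions M e p)"
  shows "spread (ring_of M) (solutions M e p)"
proof (rule ccontr)
  assume "\<not> spread (ring_of M) (solutions M e p)"
  then obtain u where u: "u \<in> univ M" and
    nocoll: "\<not> (let S = solutions M e p in \<exists>a\<in>S. \<exists>b\<in>S. \<exists>c\<in>S. \<exists>d\<in>S. c \<noteq> d \<and>
       a \<oplus>\<^bsub>ring_of M\<^esub> u \<otimes>\<^bsub>ring_of M\<^esub> c = b \<oplus>\<^bsub>ring_of M\<^esub> u \<otimes>\<^bsub>ring_of M\<^esub> d)"
    unfolding spread_def Let_def carrier_ring_of by blast
  \<comment> \<open>Making u the first parameter puts its counterpart into \<open>g 2\<close> once
    two points are adjoined, and that of \<open>e v\<close> into \<open>g (v + 3)\<close>.\<close>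
  define e1 where "e1 = case_nat u e"
  define p1 where "p1 = ren (case_nat 0 (\<lambda>v. Suc (Suc v))) p"
  have M': "is_struc L M" using M unfolding is_model_def by blast
  have e1: "range e1 \<subseteq> univ M" using e u unfolding e1_def range_case_nat by blast
  have "solutions M e1 p1 = solutions M e p"
    unfolding p1_def solutions_ren_Suc e1_def by simp
  then have "\<forall>q\<in>set [p1, p1]. is_formula L q \<and> infinite (solutions M e1 q)"
    using p inf by (auto simp: p1_def)
  from independent_extension [OF large M' e1 this] obtain N :: "(ring_sym + 'f, 'r, 'u) struc" and g
    where N: "is_struc L N" "range g \<subseteq> univ N" and eq: "elem_equiv L M e1 N (\<lambda>v. g (v + 2))"
      and sol: "\<And>i. i < 2 \<Longrightarrow> g i \<in> solutions N (\<lambda>v. g (v + 2)) ([p1, p1] ! i)"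
      and na: "\<And>i. i < 2 \<Longrightarrow> g i \<notin> acl L N (range (\<lambda>v. g (v + Suc i)))"
    by (auto simp: numeral_2_eq_2)
  have gN: "g i \<in> univ N" for i using N(2) by blast
  define A where "A = range (\<lambda>v. g (v + 2))"
  have A: "A \<subseteq> univ N" "countable A" "A \<noteq> {}" using gN unfolding A_def by auto
  have mod: "is_model L T N"
    by (rule elem_equiv_model [OF eq T_theory M N(1) e1]) (use gN in auto)
  interpret R: field "ring_of N" by (rule model_field [OF mod])
  let ?R = "ring_of N"
  define S where "S = solutions N (\<lambda>v. g (v + 3)) p"
  have S01: "g 0 \<in> S" "g 1 \<in> S"
    using sol [of 0] sol [of 1] unfolding p1_def S_def
    by (simp_all add: solutions_ren_Suc numeral_eq_Suc)
  have SN: "S \<subseteq> univ N" unfolding S_def solutions_def by blast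
  \<comment> \<open>Truncated subtraction puts u into slot 4 and \<open>e v\<close> into slot
    \<open>v + 5\<close>, as \<open>collision_fm\<close> requires; slots 0 to 3 are bound
    there.\<close>
  have "\<not> sat M (\<lambda>v. e1 (v - 4)) (collision_fm p)"
    unfolding sat_collision_fm using nocoll by (simp add: e1_def)
  then have "\<not> sat N (\<lambda>v. g (v - 4 + 2)) (collision_fm p)"
    using elem_equivD [OF elem_equiv_comp [OF eq, of "\<lambda>v. v - 4"]] p
      is_formula_collision_fm [OF ring] by blast
  moreover have "(\<lambda>v. g (v + 5 - 4 + 2)) = (\<lambda>v. g (v + 3))" by (simp add: numeral_eq_Suc)
  ultimately have inj: "c = d"
    if "a \<in> S" "b \<in> S" "c \<in> S" "d \<in> S" "a \<oplus>\<^bsub>?R\<^esub> g 2 \<otimes>\<^bsub>?R\<^esub> c = b \<oplus>\<^bsub>?R\<^esub> g 2 \<otimes>\<^bsub>?R\<^esub> d" for a b c d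
    using that unfolding sat_collision_fm S_def Let_def by (auto simp: numeral_2_eq_2)
  define z where "z = g 1 \<oplus>\<^bsub>?R\<^esub> g 2 \<otimes>\<^bsub>?R\<^esub> g 0"
  have z: "z \<in> univ N" using gN R.add.m_closed R.m_closed unfolding z_def by simp
  have uniq: "a = g 1 \<and> c = g 0" if "a \<in> S" "c \<in> S" "a \<oplus>\<^bsub>?R\<^esub> g 2 \<otimes>\<^bsub>?R\<^esub> c = z" for a c
  proof -
    have "c = g 0" using inj [OF that(1) S01(2) that(2) S01(1)] that(3) unfolding z_def by simp
    moreover from this have "a = g 1"
      using that R.add.right_cancel [of "g 2 \<otimes>\<^bsub>?R\<^esub> g 0" a "g 1"] gN SN R.m_closed unfolding z_def by auto
    ultimately show ?thesis by blast
  qed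
  \<comment> \<open>Behind the solution in slot 0 come z, the multiplier \<open>g 2\<close>, a
    filler for slot 3, which q binds, and the parameters of p from slot 4.\<close>
  define f where "f = case_nat z (case_nat (g 2) (case_nat z (\<lambda>v. g (v + 3))))"
  have A3: "A = insert (g 2) (range (\<lambda>v. g (v + 3)))"
    unfolding A_def using range_shift [of g 2] by simp
  then have f: "range f \<subseteq> insert z A" "range f \<subseteq> univ N"
    using A z unfolding f_def range_case_nat by auto
  \<comment> \<open>For the two terms \<open>?t1\<close> and \<open>?t0\<close>, injectivity leaves
    exactly one solution, so each of \<open>g 1\<close> and \<open>g 0\<close> is defined by z over
    A.\<close>
  define q where "q = (\<lambda>t. Exi 3 (And (And (ren (case_nat 0 (\<lambda>v. v + 4)) p) (ren (case_nat 3 (\<lambda>v. v + 4)) p))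
     (Eq t (Var 1))))"
  have fS: "(\<lambda>v. ((case_nat a f)(3 := c)) (v + 4)) = (\<lambda>v. g (v + 3))" for a c
    by (auto simp: f_def numeral_eq_Suc)
  have slots: "((case_nat a f)(3 := c)) 0 = a" "((case_nat a f)(3 := c)) 1 = z"
    "((case_nat a f)(3 := c)) 2 = g 2" "((case_nat a f)(3 := c)) 3 = c" for a c
    by (simp_all add: f_def numeral_eq_Suc)
  have q: "solutions N f (q t) = {a \<in> S. \<exists>c\<in>S. tval N ((case_nat a f)(3 := c)) t = z}" for t
    unfolding solutions_def [of N f] q_def sat.simps(1,4,5) sat_ren_case_nat fS slots tval.simps(1)
    unfolding S_def solutions_def by blast
  have qf: "is_formula L (q t)" if "is_term L t" for t
    using p that unfolding q_def by simp
  let ?t1 = "tplus (Var 0) (ttimes (Var 2) (Var 3))" and ?t0 = "tplus (Var 3) (ttimes (Var 2) (Var 0))"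
  have "solutions N f (q ?t1) = {g 1}" "solutions N f (q ?t0) = {g 0}"
    unfolding q tval_ring tval.simps(1) slots using uniq S01 z_def by auto
  then have 1: "g 1 \<in> acl L N (insert z A)" and 0: "g 0 \<in> acl L N (insert z A)"
    using f acl_memI [of _ N f "q ?t1"] acl_memI [of _ N f "q ?t0"] qf sublang_L_ring [OF ring] by simp_all
  have "g 1 \<notin> acl L N A" using na [of 1] unfolding A_def by (simp add: numeral_2_eq_2)
  then have "z \<in> acl L N (insert (g 1) A)" using exchange [OF mod A(1) gN z 1] by blast
  moreover have "g 0 \<in> acl L N (insert z (insert (g 1) A))"
    using 0 acl_mono [of "insert z A" "insert z (insert (g 1) A)"] by blast
  ultimately have "g 0 \<in> acl L N (insert (g 1) A)"
    using A gN acl_trans [OF N(1), of "insert (g 1) A" z "g 0"] by simp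
  moreover have "range (\<lambda>v. g (v + Suc 0)) = insert (g 1) A"
    unfolding A_def using range_shift [of g 1] by (simp add: numeral_2_eq_2)
  ultimately show False using na [of 0] by simp
qed

text \<open>Why y and y' stay nonalgebraic over A, c, d: inverting the line would make x (or x')
  algebraic over A, c, d as well. This costs c, d one dimension over A, x, x', where they would have
  rank at most one; but there they generate the two independent points y and y'.\<close>

lemma affine_image_splits:
  fixes M :: "(ring_sym + 'f, 'r, 'v) struc"
  assumes M: "is_model L T M" and e: "range e \<subseteq> univ M"
    and p: "is_formula L p" "infinite (solutions M e p)" "infinite (univ M - solutions M e p)"
    and q: "is_formula L q" "infinite (solutions M e q)"
  shows "\<exists>c\<in>univ M. \<exists>d\<in>univ M.
    infinite (solutions M e q \<inter> affine_image (ring_of M) (solutions M e p) (c, d)) \<and>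
    infinite (solutions M e q - affine_image (ring_of M) (solutions M e p) (c, d))"
proof (rule ccontr)
  assume none: "\<not> ?thesis"
  have M': "is_struc L M" using M unfolding is_model_def by blast
  interpret K: field "ring_of M" by (rule model_field [OF M])
  have "infinite S" if "spread (ring_of M) S" "S \<subseteq> univ M" for S
    using K.spread_imp_infinite that model_infinite [OF M] by simp
  moreover have "solutions M f r \<subseteq> univ M" for f r unfolding solutions_def by blast
  ultimately have "infinite (solutions M f r)" if "spread (ring_of M) (solutions M f r)" for f r
    using that by blast
  \<comment> \<open>\<open>v - 8\<close> is truncated, so slots 7 and 8 both hold
    \<open>e 0\<close>, as the filler demands.\<close>
  then have nM: "\<not> sat M (\<lambda>v. e (v - 8)) (split_fm q p)"
    using none unfolding solutions_affine [symmetric] by (subst sat_split_fm) (simp, simp, blast)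
  \<comment> \<open>In slot order the points are y' = \<open>g 0\<close>, y = \<open>g 1\<close>, x'
    = \<open>g 2\<close> and x = \<open>g 3\<close>.\<close>
  have "\<forall>r\<in>set [q, q, Neg p, p]. is_formula L r \<and> infinite (solutions M e r)"
    using p q by (auto simp: solutions_Neg)
  from independent_extension [OF large M' e this] obtain N :: "(ring_sym + 'f, 'r, 'u) struc" and g
    where N: "is_struc L N" "range g \<subseteq> univ N" and eq: "elem_equiv L M e N (\<lambda>v. g (v + 4))"
      and sol: "\<And>i. i < 4 \<Longrightarrow> g i \<in> solutions N (\<lambda>v. g (v + 4)) ([q, q, Neg p, p] ! i)"
      and na: "\<And>i. i < 4 \<Longrightarrow> g i \<notin> acl L N (range (\<lambda>v. g (v + Suc i)))"
    by (auto simp: numeral_eq_Suc)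
  have gN: "g i \<in> univ N" for i using N(2) by blast
  define e' where "e' = (\<lambda>v. g (v + 4))"
  define A where "A = range e'"
  have e': "range e' \<subseteq> univ N" using gN unfolding e'_def by auto
  have A: "A \<subseteq> univ N" "countable A" using e' unfolding A_def by auto
  have mod: "is_model L T N"
    by (rule elem_equiv_model [OF eq T_theory M N(1) e]) (use gN in auto)
  interpret R: field "ring_of N" by (rule model_field [OF mod])
  let ?R = "ring_of N"
  define X Y where "X = solutions N e' p" and "Y = solutions N e' q"
  have in_sets: "g 3 \<in> X" "g 2 \<notin> X" "g 1 \<in> Y" "g 0 \<in> Y"
    using sol [of 3] sol [of 2] sol [of 1] sol [of 0]
    unfolding X_def Y_def e'_def by (simp_all add: solutions_Neg)
  have XN: "X \<subseteq> univ N" unfolding X_def solutions_def by blast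
  define B where "B = insert (g 2) (insert (g 3) A)"
  have r4: "range (\<lambda>v. g (v + 4)) = A" unfolding A_def e'_def ..
  have r3: "range (\<lambda>v. g (v + 3)) = insert (g 3) A" using range_shift [of g 3] r4 by simp
  have r2: "range (\<lambda>v. g (v + 2)) = B" using range_shift [of g 2] r3 unfolding B_def by simp
  have r1: "range (\<lambda>v. g (v + 1)) = insert (g 1) B" using range_shift [of g 1] r2 by (simp add: numeral_2_eq_2)
  have indep: "g 3 \<notin> acl L N A" "g 2 \<notin> acl L N (insert (g 3) A)" "g 1 \<notin> acl L N B"
    "g 0 \<notin> acl L N (insert (g 1) B)"
    using na [of 3] na [of 2] na [of 1] na [of 0] r1 r2 r3 r4 by (simp_all add: numeral_eq_Suc)
  have B: "A \<subseteq> B" "B \<subseteq> univ N" "countable B" "g 3 \<in> B" "g 2 \<in> B"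
    using A gN unfolding B_def by auto
  have refl: "a \<in> acl L N C" if "a \<in> C" "C \<subseteq> univ N" for a C
  proof (rule acl_memI)
    show "a \<in> solutions N (\<lambda>_. a) (Eq (Var 0) (Var 1))" using that by (auto simp: solutions_def)
    have "solutions N (\<lambda>_. a) (Eq (Var 0) (Var 1)) \<subseteq> {a}" by (auto simp: solutions_def)
    then show "finite (solutions N (\<lambda>_. a) (Eq (Var 0) (Var 1)))" by (rule finite_subset) simp
  qed (use that in auto)
  have "g 3 \<noteq> g 2" using in_sets(1,2) by metis
  moreover have "g 1 \<noteq> g 0"
    using indep(4) refl [of "g 0" "insert (g 1) B"] B gN by auto
  ultimately obtain c d where cd: "c \<in> univ N" "d \<in> univ N" "c \<noteq> \<zero>\<^bsub>?R\<^esub>"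
    and line: "g 1 = c \<otimes>\<^bsub>?R\<^esub> g 3 \<oplus>\<^bsub>?R\<^esub> d" "g 0 = c \<otimes>\<^bsub>?R\<^esub> g 2 \<oplus>\<^bsub>?R\<^esub> d"
    using R.line_through [of "g 3" "g 2" "g 1" "g 0"] gN by (metis carrier_ring_of)
  have slope: "w = w'" if "c \<otimes>\<^bsub>?R\<^esub> w \<oplus>\<^bsub>?R\<^esub> d = c \<otimes>\<^bsub>?R\<^esub> w' \<oplus>\<^bsub>?R\<^esub> d" "w \<in> univ N" "w' \<in> univ N" for w w'
    using that cd R.m_lcancel [of c w w'] R.add.right_cancel [of d "c \<otimes>\<^bsub>?R\<^esub> w" "c \<otimes>\<^bsub>?R\<^esub> w'"]
      R.m_closed [of c] by simp
  define P where "P = affine_params c d e'"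
  have P: "range P = insert c (insert d A)" unfolding P_def range_affine_params A_def ..
  have PN: "range P \<subseteq> univ N" unfolding P using A cd by blast
  \<comment> \<open>The slope is nonzero, so w is the only solution of y = c w + d.\<close>
  have pull: "w \<in> acl L N (insert c (insert d A))"
    if "c \<otimes>\<^bsub>?R\<^esub> w \<oplus>\<^bsub>?R\<^esub> d \<in> acl L N (insert c (insert d A))" "w \<in> univ N" for w
  proof (rule acl_trans [OF N(1) _ _ _ that(1)])
    let ?y = "c \<otimes>\<^bsub>?R\<^esub> w \<oplus>\<^bsub>?R\<^esub> d"
    have y: "?y \<in> univ N" using cd that(2) R.m_closed R.add.m_closed by simp
    let ?f = "case_nat ?y (case_nat c (\<lambda>_. d))" and ?r = "Eq (Var 1) (tplus (ttimes (Var 2) (Var 0)) (Var 3))"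
    have "solutions N ?f ?r = {w}"
      using slope that(2) by (auto simp: solutions_def numeral_eq_Suc ring_of_def)
    then show "w \<in> acl L N (insert ?y (insert c (insert d A)))"
      using y cd that(2) sublang_L_ring [OF ring]
      by (intro acl_memI [of _ N ?f ?r]) (auto simp: range_case_nat)
  qed (use A cd in auto)
  have push: "c \<otimes>\<^bsub>?R\<^esub> w \<oplus>\<^bsub>?R\<^esub> d \<in> acl L N (insert c (insert d B))" if "w \<in> B" for w
  proof -
    let ?y = "c \<otimes>\<^bsub>?R\<^esub> w \<oplus>\<^bsub>?R\<^esub> d"
    have y: "?y \<in> univ N" using cd that B R.m_closed R.add.m_closed by (simp add: subset_iff)
    let ?f = "case_nat c (case_nat w (\<lambda>_. d))" and ?r = "Eq (Var 0) (tplus (ttimes (Var 1) (Var 2)) (Var 3))"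
    have "solutions N ?f ?r = {?y}"
      using y by (auto simp: solutions_def numeral_eq_Suc ring_of_def)
    then show ?thesis
      using that cd B sublang_L_ring [OF ring]
      by (intro acl_memI [of _ N ?f ?r]) (auto simp: range_case_nat)
  qed
  have gen: "g 1 \<in> acl L N (insert c (insert d B))" "g 0 \<in> acl L N (insert c (insert d B))"
    using push [OF B(4)] push [OF B(5)] line by simp_all
  have rank: False if "w \<in> B" "w \<notin> acl L N A" "w \<in> acl L N (insert c (insert d A))" for w
    by (rule exchange_rank_argument [OF N(1) _ B(1-3) that(1) cd(1,2) gN gN that(2,3) indep(3,4) gen])
      (rule exchange [OF mod])
  have "g 2 \<notin> acl L N A" using indep(2) acl_mono [of A "insert (g 3) A"] by blast
  then have na': "g 1 \<notin> acl L N (range P)" "g 0 \<notin> acl L N (range P)"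
    using rank [OF B(4) indep(1)] rank [OF B(5)] pull [OF _ gN] line unfolding P by metis+
  \<comment> \<open>A definable set containing a nonalgebraic point is infinite; the points used are
    y for the intersection and y' for the difference.\<close>
  have "infinite (solutions N P r)" if "is_formula L r" "g i \<in> solutions N P r" "g i \<notin> acl L N (range P)" for r i
    using that unfolding acl_range_iff [OF PN] solutions_def by blast
  moreover have "g 1 \<in> solutions N P (affine_inter_fm q p)"
    using in_sets line unfolding P_def solutions_affine X_def Y_def affine_image_def by auto
  moreover have "g 0 \<notin> affine_image ?R X (c, d)"
    using slope [of "g 2"] in_sets XN gN line unfolding affine_image_def by auto
  then have "g 0 \<in> solutions N P (affine_diff_fm q p)"
    using in_sets unfolding P_def solutions_affine X_def Y_def by auto
  ultimately have "infinite (solutions N P (affine_inter_fm q p))" "infinite (solutions N P (affine_diff_fm q p))"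
    using na' is_formula_affine_inter_diff [OF ring] p q by blast+
  then have "spread ?R (solutions N P (affine_inter_fm q p))" "spread ?R (solutions N P (affine_diff_fm q p))"
    using infinite_imp_spread [OF mod PN] is_formula_affine_inter_diff [OF ring] p q by blast+
  then have "sat N (\<lambda>v. e' (v - 8)) (split_fm q p)"
    using cd unfolding P_def by (subst sat_split_fm) auto
  moreover have "is_formula L (split_fm q p)"
    using p q is_formula_affine_inter_diff [OF ring] is_formula_collision_fm [OF ring]
    unfolding split_fm_def by simp
  ultimately show False
    using nM elem_equivD [OF elem_equiv_comp [OF eq, of "\<lambda>v. v - 8"]] unfolding e'_def by blast
qed

end


section \<open>The order property\<close>

text \<open>
  A point \<open>h\<close> two-colours the parameters, and below some set of \<open>\<F>\<close> the parameters of one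
  colour already split everything.  Iterating yields a half graph up to the choice of a colour
  at each step, which is made constant by passing to a subsequence.
\<close>

lemma half_graph_if_always_split:
  fixes R :: "'h \<Rightarrow> 'p \<Rightarrow> bool"
  assumes ne: "{} \<notin> \<F>" and Y0: "Y0 \<in> \<F>"
    and split: "\<forall>Y\<in>\<F>. \<exists>a\<in>P0. \<forall>c. {h \<in> Y. R h a = c} \<in> \<F>"
  obtains h :: "nat \<Rightarrow> 'h" and a :: "nat \<Rightarrow> 'p" where "range h \<subseteq> Y0" "range a \<subseteq> P0"
    "(\<forall>i j. R (h i) (a j) \<longleftrightarrow> i < j) \<or> (\<forall>i j. R (h i) (a j) \<longleftrightarrow> j < i)"
proof -
  \<comment> \<open>Splits are demanded only densely, in some W below each Z. Thus the condition
    passes to smaller members of the family, and one of any two colour classes keeps it below some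
    member.\<close>
  define hered where "hered = (\<lambda>Y P. Y \<in> \<F> \<and> P \<subseteq> P0 \<and>
    (\<forall>Z\<in>\<F>. Z \<subseteq> Y \<longrightarrow> (\<exists>W\<in>\<F>. W \<subseteq> Z \<and> (\<exists>a\<in>P. \<forall>c. {h \<in> W. R h a = c} \<in> \<F>))))"
  have start: "hered Y0 P0" unfolding hered_def using Y0 split by blast
  have step: "\<exists>h c a Y' P'. h \<in> Y \<and> Y' \<subseteq> Y \<and> P' \<subseteq> P \<and> a \<in> P' \<and> hered Y' P' \<and>
      (\<forall>b\<in>P'. R h b = c) \<and> (\<forall>k\<in>Y'. R k a \<noteq> c)" if Y: "hered Y P" for Y P
  proof -
    have "Y \<noteq> {}" using ne Y unfolding hered_def by auto
    then obtain h where h: "h \<in> Y" by blast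
    define Q where "Q = (\<lambda>c. {b \<in> P. R h b = c})"
    have "\<exists>Z c. Z \<subseteq> Y \<and> hered Z (Q c)"
    proof (cases "\<exists>Z. Z \<subseteq> Y \<and> hered Z (Q True)")
      case False
      \<comment> \<open>Failure of \<open>Q True\<close> below Z yields Z' inside Z where no
        parameter of colour True splits anything. The parameter that P supplies below Z' must then
        have colour False.\<close>
      have "hered Y (Q False)"
        unfolding hered_def
      proof (intro conjI ballI impI)
        fix Z assume Z: "Z \<in> \<F>" "Z \<subseteq> Y"
        have "\<not> hered Z (Q True)" using False Z by blast
        moreover have "Q True \<subseteq> P0" using Y unfolding Q_def hered_def by blast
        ultimately obtain Z' where Z': "Z' \<in> \<F>" "Z' \<subseteq> Z"
          "\<And>W a. W \<in> \<F> \<Longrightarrow> W \<subseteq> Z' \<Longrightarrow> a \<in> Q True \<Longrightarrow> \<not> (\<forall>c. {h \<in> W. R h a = c} \<in> \<F>)"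
          using Z(1) unfolding hered_def by metis
        moreover have "Z' \<subseteq> Y" using Z' Z by blast
        ultimately obtain W a where W: "W \<in> \<F>" "W \<subseteq> Z'" "a \<in> P" "\<forall>c. {h \<in> W. R h a = c} \<in> \<F>"
          using Y unfolding hered_def by metis
        then have "a \<notin> Q True" using Z'(3) by blast
        then have "a \<in> Q False" using W(3) unfolding Q_def by simp
        then show "\<exists>W\<in>\<F>. W \<subseteq> Z \<and> (\<exists>a\<in>Q False. \<forall>c. {h \<in> W. R h a = c} \<in> \<F>)"
          using W Z'(2) by blast
      qed (use Y in \<open>auto simp: hered_def Q_def\<close>)
      then show ?thesis by blast
    qed blast
    then obtain Z c where Z: "Z \<subseteq> Y" "hered Z (Q c)" by blast
    then obtain W a where W: "W \<subseteq> Z" "a \<in> Q c" "\<forall>c. {h \<in> W. R h a = c} \<in> \<F>"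
      unfolding hered_def by blast
    \<comment> \<open>All parameters kept see h in colour c; all later points see the chosen a in
      the opposite colour. This fixes both sides of the half graph.\<close>
    define Y' where "Y' = {h \<in> W. R h a = (\<not> c)}"
    have "Y' \<subseteq> Z" "Y' \<in> \<F>" using W unfolding Y'_def by auto
    then have "hered Y' (Q c)" using Z(2) unfolding hered_def by (meson order_trans)
    moreover have "Y' \<subseteq> Y" using \<open>Y' \<subseteq> Z\<close> Z(1) by blast
    moreover have "Q c \<subseteq> P" "\<forall>b\<in>Q c. R h b = c" "\<forall>k\<in>Y'. R k a \<noteq> c"
      unfolding Q_def Y'_def by auto
    ultimately show ?thesis using h W(2) by blast
  qed
  define good :: "'h \<times> bool \<times> 'p \<times> 'h set \<times> 'p set \<Rightarrow> bool" where "good = (\<lambda>(h, c, a, Y, P). hered Y P)"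
  define next_state :: "'h \<times> bool \<times> 'p \<times> 'h set \<times> 'p set \<Rightarrow> 'h \<times> bool \<times> 'p \<times> 'h set \<times> 'p set \<Rightarrow> bool"
    where "next_state = (\<lambda>(h, c, a, Y, P) (h', c', a', Y', P').
    h' \<in> Y \<and> Y' \<subseteq> Y \<and> P' \<subseteq> P \<and> a' \<in> P' \<and> (\<forall>b\<in>P'. R h' b = c') \<and> (\<forall>k\<in>Y'. R k a' \<noteq> c'))"
  have "\<exists>t. good t \<and> next_state u t" if "good u" for u
  proof -
    obtain h c a Y P where u: "u = (h, c, a, Y, P)" by (cases u)
    with that have "hered Y P" unfolding good_def by simp
    from step [OF this] obtain h' c' a' Y' P' where
      "h' \<in> Y \<and> Y' \<subseteq> Y \<and> P' \<subseteq> P \<and> a' \<in> P' \<and> hered Y' P' \<and>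
        (\<forall>b\<in>P'. R h' b = c') \<and> (\<forall>k\<in>Y'. R k a' \<noteq> c')" by blast
    then show ?thesis
      unfolding u by (intro exI [of _ "(h', c', a', Y', P')"]) (simp add: good_def next_state_def)
  qed
  then obtain nxt where nxt: "\<And>u. good u \<Longrightarrow> good (nxt u) \<and> next_state u (nxt u)" by metis
  \<comment> \<open>Points, colours and parameters are read off from stage 1 on, so their initial
    values do not matter.\<close>
  define s where "s = rec_nat (undefined, undefined, undefined, Y0, P0) (\<lambda>_. nxt)"
  have s0: "s 0 = (undefined, undefined, undefined, Y0, P0)" and S: "s (Suc n) = nxt (s n)" for n
    unfolding s_def by simp_all
  have good: "good (s n)" for n
    by (induction n) (use s0 S nxt start in \<open>auto simp: good_def\<close>)
  have s: "next_state (s n) (s (Suc n))" for n using nxt [OF good] S by simp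
  define h where "h = (\<lambda>n. fst (s (Suc n)))"
  define c where "c = (\<lambda>n. fst (snd (s (Suc n))))"
  define a where "a = (\<lambda>n. fst (snd (snd (s (Suc n)))))"
  define Y where "Y = (\<lambda>n. fst (snd (snd (snd (s n)))))"
  define P where "P = (\<lambda>n. snd (snd (snd (snd (s n)))))"
  have step': "h n \<in> Y n \<and> Y (Suc n) \<subseteq> Y n \<and> P (Suc n) \<subseteq> P n \<and> a n \<in> P (Suc n) \<and>
      (\<forall>b\<in>P (Suc n). R (h n) b = c n) \<and> (\<forall>k\<in>Y (Suc n). R k (a n) \<noteq> c n)" for n
    using s [of n] unfolding next_state_def h_def c_def a_def Y_def P_def by (simp add: split_beta)
  have Y: "Y m \<subseteq> Y n" and P: "P m \<subseteq> P n" if "n \<le> m" for n m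
    using that step' lift_Suc_antimono_le [of Y n m] lift_Suc_antimono_le [of P n m] by auto
  have Y0P0: "Y 0 = Y0" "P 0 = P0" using s0 unfolding Y_def P_def by auto
  have hY: "h n \<in> Y0" and aP: "a n \<in> P0" for n
    using step' [of n] Y [of 0 n] P [of 0 "Suc n"] Y0P0 by auto
  have lt: "R (h i) (a j) \<noteq> c j" if "j < i" for i j
    using step' [of i] step' [of j] Y [of "Suc j" i] that by auto
  have ge: "R (h i) (a j) = c i" if "i \<le> j" for i j
    using step' [of i] step' [of j] P [of "Suc i" "Suc j"] that by auto
  have "\<exists>v. infinite {n. c n = v}"
  proof (rule ccontr)
    assume "\<nexists>v. infinite {n. c n = v}"
    then have "finite ({n. c n = True} \<union> {n. c n = False})" by blast
    moreover have "{n. c n = True} \<union> {n. c n = False} = UNIV" by auto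
    ultimately show False using infinite_UNIV_nat by metis
  qed
  then obtain v where "infinite {n. c n = v}" ..
  then obtain r :: "nat \<Rightarrow> nat" where r: "strict_mono r" "\<And>n. c (r n) = v"
    using infinite_enumerate by blast
  have rr: "R (h (r i)) (a (r j)) \<longleftrightarrow> (if i \<le> j then v else \<not> v)" for i j
    using lt [of "r j" "r i"] ge [of "r i" "r j"] r
    by (auto simp: strict_mono_less strict_mono_less_eq not_le)
  show thesis
  proof (cases v)
    \<comment> \<open>Here the relation is i <= j. Odd indices for points and even ones for
      parameters make it strict, as 2i + 1 <= 2j if and only if i < j.\<close>
    case True
    show thesis
      by (rule that [of "\<lambda>i. h (r (2 * i + 1))" "\<lambda>j. a (r (2 * j))"])
        (use hY aP rr True in auto)
  next
    case False
    show thesis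
      by (rule that [of "\<lambda>i. h (r i)" "\<lambda>j. a (r j)"]) (use hY aP rr False in auto)
  qed
qed

text \<open>Stability is assumed for models in \<open>'u\<close>, so instability found elsewhere has
  to be moved there. The doubly indexed families a and b are countable; pairing packs them into one
  assignment, and every instance of p becomes a renaming of p evaluated under it.\<close>

lemma order_property_transfer:
  fixes M :: "('f, 'r, 'v) struc"
  assumes large: "large_for TYPE('u) L" and M: "is_struc L M" and p: "is_formula L p"
    and op: "order_property_in M p V"
  obtains N :: "('f, 'r, 'u) struc" and e f where "is_struc L N" "range e \<subseteq> univ M" "range f \<subseteq> univ N"
    "elem_equiv L M e N f" "order_property_in N p V"
proof -
  obtain a b :: "nat \<Rightarrow> nat \<Rightarrow> 'v" where ab: "\<And>i. range (a i) \<subseteq> univ M" "\<And>j. range (b j) \<subseteq> univ M"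
    and ord: "\<And>i j. sat M (\<lambda>x. if x \<in> V then a i x else b j x) p \<longleftrightarrow> i < j"
    using op unfolding order_property_in_def by blast
  define e where "e = (\<lambda>n. case sum_decode n of Inl k \<Rightarrow> case_prod a (prod_decode k)
    | Inr k \<Rightarrow> case_prod b (prod_decode k))"
  define s t where "s = (\<lambda>i x. sum_encode (Inl (prod_encode (i, x))))"
    and "t = (\<lambda>i x. sum_encode (Inr (prod_encode (i, x))))"
  have st: "e (s i x) = a i x" "e (t i x) = b i x" for i x
    unfolding e_def s_def t_def by simp_all
  have "e n \<in> univ M" for n
    unfolding e_def using range_subsetD [OF ab(1)] range_subsetD [OF ab(2)]
    by (simp split: sum.split prod.split)
  then have e: "range e \<subseteq> univ M" by blast
  obtain N :: "('f, 'r, 'u) struc" and f where N: "is_struc L N" "range f \<subseteq> univ N" "elem_equiv L M e N f"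
    using downward_loewenheim_skolem [OF large M e] by metis
  have "sat N (\<lambda>x. if x \<in> V then f (s i x) else f (t j x)) p \<longleftrightarrow> i < j" for i j
  proof -
    have *: "(\<lambda>x. k (if x \<in> V then s i x else t j x)) = (\<lambda>x. if x \<in> V then k (s i x) else k (t j x))"
      for k :: "nat \<Rightarrow> 'x" by auto
    show ?thesis
      using elem_equivD [OF elem_equiv_comp [OF N(3), of "\<lambda>x. if x \<in> V then s i x else t j x"] p]
      unfolding * st ord by blast
  qed
  then have "order_property_in N p V"
    unfolding order_property_in_def using N(2)
    by (intro exI [of _ "\<lambda>i x. f (s i x)"] exI [of _ "\<lambda>j x. f (t j x)"]) auto
  then show thesis using that N e by blast
qed

lemma definable_over_univ:
  assumes M: "is_struc L M" and X: "definable_over L M (univ M) X"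
  obtains p e where "is_formula L p" "range e \<subseteq> univ M" "X = solutions M e p"
proof -
  obtain p x f where p: "is_formula L p" "\<forall>y\<in>fv p - {x}. f y \<in> univ M"
    and X: "X = {c \<in> univ M. sat M (f(x := c)) p}"
    using X unfolding definable_over_def by blast
  obtain a where a: "a \<in> univ M" using is_struc_nonempty [OF M] by blast
  \<comment> \<open>\<open>definable_over\<close> constrains f only at the free variables other than
    x; elsewhere its values may leave the universe and are replaced.\<close>
  define e where "e = (\<lambda>y. if f y \<in> univ M then f y else a)"
  let ?q = "ren (\<lambda>v. if v = x then 0 else Suc v) p"
  have "sat M (case_nat c e) ?q = sat M (f(x := c)) p" for c
    unfolding sat_ren using p(2) by (intro sat_cong) (auto simp: e_def)
  then have "X = solutions M e ?q" unfolding X solutions_def by simp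
  moreover have "range e \<subseteq> univ M" unfolding e_def using a by auto
  moreover have "is_formula L ?q" using p(1) by simp
  ultimately show thesis using that by blast
qed

context pregeometric_field_theory
begin

lemma order_property_if_not_minimal:
  fixes M :: "(ring_sym + 'f, 'r, 'v) struc"
  assumes M: "is_model L T M" and e: "range e \<subseteq> univ M" and p: "is_formula L p"
    and X: "infinite (solutions M e p)" "infinite (univ M - solutions M e p)"
  shows "\<exists>V. order_property_in M (affine_fm p) V"
proof -
  have M': "is_struc L M" using M unfolding is_model_def by blast
  let ?R = "ring_of M"
  define X where "X = solutions M e p"
  define \<F> where "\<F> = {Y. infinite Y \<and> (\<exists>q f. is_formula L q \<and> range f \<subseteq> univ M \<and> Y = solutions M f q)}"
  have "univ M = solutions M e (Eq (Var 0) (Var 0))" unfolding solutions_def by simp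
  moreover have "is_formula L (Eq (Var 0) (Var 0))" by simp
  ultimately have univ: "univ M \<in> \<F>" using model_infinite [OF M] e unfolding \<F>_def by blast
  have split: "\<forall>Y\<in>\<F>. \<exists>t\<in>univ M \<times> univ M. \<forall>v. {z \<in> Y. (z \<in> affine_image ?R X t) = v} \<in> \<F>"
  proof
    fix Y assume Y: "Y \<in> \<F>"
    obtain q f where q: "is_formula L q" "range f \<subseteq> univ M" and Yq: "Y = solutions M f q" "infinite Y"
      using Y unfolding \<F>_def by blast
    \<comment> \<open>Interleaving e and f gives both formulas a common assignment, as
      \<open>affine_image_splits\<close> requires.\<close>
    define k where "k = (\<lambda>n. if even n then e (n div 2) else f (n div 2))"
    define p' where "p' = ren (case_nat 0 (\<lambda>v. Suc (2 * v))) p"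
    define q' where "q' = ren (case_nat 0 (\<lambda>v. Suc (2 * v + 1))) q"
    have k: "range k \<subseteq> univ M" using e q(2) unfolding k_def by auto
    have X': "solutions M k p' = X" and Y': "solutions M k q' = Y"
      unfolding p'_def q'_def solutions_ren_Suc X_def Yq k_def by simp_all
    have pq: "is_formula L p'" "is_formula L q'" using p q unfolding p'_def q'_def by auto
    obtain c d where cd: "c \<in> univ M" "d \<in> univ M" "infinite (Y \<inter> affine_image ?R X (c, d))"
      "infinite (Y - affine_image ?R X (c, d))"
      using affine_image_splits [OF M k pq(1) _ _ pq(2)] X Yq(2) unfolding X' Y' X_def by blast
    let ?k = "affine_params c d k"
    have "range ?k \<subseteq> univ M" unfolding range_affine_params using k cd by blast
    moreover have "Y \<inter> affine_image ?R X (c, d) = solutions M ?k (affine_inter_fm q' p')"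
      "Y - affine_image ?R X (c, d) = solutions M ?k (affine_diff_fm q' p')"
      unfolding solutions_affine X' Y' by simp_all
    moreover have "is_formula L (affine_inter_fm q' p')" "is_formula L (affine_diff_fm q' p')"
      using is_formula_affine_inter_diff [OF ring] pq by blast+
    ultimately have "Y \<inter> affine_image ?R X (c, d) \<in> \<F>" "Y - affine_image ?R X (c, d) \<in> \<F>"
      using cd(3,4) unfolding \<F>_def by blast+
    moreover have "{z \<in> Y. (z \<in> affine_image ?R X (c, d)) = v} =
        (if v then Y \<inter> affine_image ?R X (c, d) else Y - affine_image ?R X (c, d))" for v
      by auto
    ultimately show "\<exists>t\<in>univ M \<times> univ M. \<forall>v. {z \<in> Y. (z \<in> affine_image ?R X t) = v} \<in> \<F>"
      using cd(1,2) by (intro bexI [of _ "(c, d)"]) auto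
  qed
  have ne: "{} \<notin> \<F>" unfolding \<F>_def by auto
  obtain h :: "nat \<Rightarrow> 'v" and t :: "nat \<Rightarrow> 'v \<times> 'v"
    where h: "range h \<subseteq> univ M" and t: "range t \<subseteq> univ M \<times> univ M"
      and ord: "(\<forall>i j. h i \<in> affine_image ?R X (t j) \<longleftrightarrow> i < j) \<or> (\<forall>i j. h i \<in> affine_image ?R X (t j) \<longleftrightarrow> j < i)"
    by (rule half_graph_if_always_split [OF ne univ split])
  define a b :: "nat \<Rightarrow> nat \<Rightarrow> 'v" where "a = (\<lambda>i _. h i)"
    and "b = (\<lambda>j. case_nat (h 0) (affine_params (fst (t j)) (snd (t j)) e))"
  have ab: "\<forall>i. range (a i) \<subseteq> univ M" "\<forall>j. range (b j) \<subseteq> univ M"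
    using h t e unfolding a_def b_def range_case_nat range_affine_params by (auto simp: mem_Times_iff image_subset_iff)
  \<comment> \<open>The half graph may come out in either direction; the reversed one is handled by
    exchanging the two tuples, that is by \<open>V = - {0}\<close>.\<close>
  have eq: "(\<lambda>x. if x \<in> {0} then a i x else b j x) = case_nat (h i) (affine_params (fst (t j)) (snd (t j)) e)"
    "(\<lambda>x. if x \<in> - {0} then b j x else a i x) = case_nat (h i) (affine_params (fst (t j)) (snd (t j)) e)" for i j
    unfolding a_def b_def by (auto split: nat.split)
  have sat: "sat M (case_nat (h i) (affine_params (fst (t j)) (snd (t j)) e)) (affine_fm p) \<longleftrightarrow>
      h i \<in> affine_image ?R X (t j)" for i j
    unfolding sat_affine_fm X_def by simp
  from ord show ?thesis
  proof
    assume "\<forall>i j. h i \<in> affine_image ?R X (t j) \<longleftrightarrow> i < j"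
    then have "order_property_in M (affine_fm p) {0}"
      unfolding order_property_in_def using ab eq(1) sat
      by (intro exI [of _ a] exI [of _ b]) simp
    then show ?thesis ..
  next
    assume "\<forall>i j. h i \<in> affine_image ?R X (t j) \<longleftrightarrow> j < i"
    then have "order_property_in M (affine_fm p) (- {0})"
      unfolding order_property_in_def using ab eq(2) sat
      by (intro exI [of _ b] exI [of _ a]) simp
    then show ?thesis ..
  qed
qed

end

theorem theorem2p5:
  fixes L :: "(ring_sym + 'f, 'r) lang"
    and T :: "(ring_sym + 'f, 'r) fm set"
  assumes "large_for TYPE('u) L"
    and "sublang L_ring L"
    and "complete_theory TYPE('u) L T"
    and "has_infinite_model TYPE('u) L T"
    and "\<forall>p\<in>field_axioms. entails TYPE('u) L T p"
    and "pregeometric TYPE('u) L T"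
    and "stable_theory TYPE('u) L T"
  shows "strongly_minimal TYPE('v) L T"
proof -
  interpret pregeometric_field_theory L T "TYPE('u)"
    using assms(1-6) by unfold_locales
  have "finite X \<or> finite (univ M - X)"
    if M: "is_model L T M" and X: "definable_over L M (univ M) X"
    for M :: "(ring_sym + 'f, 'r, 'v) struc" and X
  proof (rule ccontr)
    assume inf: "\<not> (finite X \<or> finite (univ M - X))"
    have M': "is_struc L M" using M unfolding is_model_def by blast
    obtain p e where p: "is_formula L p" and e: "range e \<subseteq> univ M" and Xp: "X = solutions M e p"
      using definable_over_univ [OF M' X] by metis
    obtain V where op: "order_property_in M (affine_fm p) V"
      using order_property_if_not_minimal [OF M e p] inf unfolding Xp by blast
    have ap: "is_formula L (affine_fm p)" using is_formula_affine_fm [OF ring] p by blast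
    obtain N :: "(ring_sym + 'f, 'r, 'u) struc" and e' f where N: "is_struc L N" "range e' \<subseteq> univ M"
      "range f \<subseteq> univ N" "elem_equiv L M e' N f" "order_property_in N (affine_fm p) V"
      using order_property_transfer [OF large M' ap op] by metis
    have "is_model L T N" by (rule elem_equiv_model [OF N(4) T_theory M N(1-3)])
    then show False using assms(7) N(5) ap unfolding stable_theory_def by blast
  qed
  then show ?thesis
    unfolding strongly_minimal_def using model_infinite by blast
qed

end
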